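(* Let $n\geq 1$ be an integer. (i) Let $\alpha>1$. With probability $1$ there exists a random integer $M_0=M_0(n)\geq 1$ such that, for any integer $M\geq M_0$, the trajectory of any particle contributing to $A_n[\infty]$ and starting from $(0,i)$ with $|i|>M^{\alpha}$ does not visit the horizontal strip $\mathbb{Z}_M$. (ii) The same holds for $A_n^\ast[\infty]$: for $\alpha>1$, with probability $1$ there exists a random integer $M_0=M_0(n)\geq 1$ such that, for any integer $M\geq M_0$, the trajectory of any particle contributing to $A_n^*[\infty]$ and starting from $(0,i)$ with $|i|>M^{\alpha}$ does not visit $\mathbb{Z}_M$.
   Context: Let $(S_{i,j})_{i\in\mathbb{Z},j\geq1}$ be independent simple symmetric random walks on $\mathbb{Z}^2$, $S_{i,j}$ starting at $(0,i)$. When the current aggregate is $A\subset\mathbb{Z}^2$, sending particle $(i,j)$ (from level $i$) means: follow $S_{i,j}$ until the first time (possibly time $0$) it is at a site $z\notin A$; the particle stops there and the aggregate becomes $A\cup\{z\}$. The trajectory of a particle is the random walk path up to this stopping time. $A_n[M]$ ($M\geq0$) is the aggregate obtained from $\emptyset$ by sending $n$ particles from each level $i$ with $|i|\le M$ in the usual order: first $n$ particles from level $0$, then $n$ from level $1$, then $n$ from level $-1$, then $n$ from level $2$, and so on, up to levels $M$ then $-M$. $A_n[\infty]=\bigcup_{M\geq0}A_n[M]$ (increasing union). Let $(N_i)_{i\in\mathbb{Z}}$ be i.i.d. Poisson random variables with parameter $n$, independent of the walks. $A_n^*[M]$ is obtained in the same way, in the usual order of levels $0,1,-1,2,-2,\dots,M,-M$,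 but sending $N_i$ particles from each level $i$ instead of $n$. $A_n^*[\infty]=\bigcup_{M\geq0}A_n^*[M]$. The strip is $\mathbb{Z}_M=\mathbb{Z}\times([-M,M]\cap\mathbb{Z})$. *)

theory Defs
  imports "HOL-Probability.Probability"
begin

type_synonym site = "int \<times> int"

section \<open>The aggregation dynamics for fixed walk paths\<close>

text \<open>\<open>w i j t\<close> is the position at time \<open>t\<close> of the walk driving particle \<open>(i, j)\<close>, the
  \<open>j\<close>-th particle sent from level \<open>i\<close> (\<open>j \<ge> 1\<close>); \<open>c i\<close> is the number of particles sent
  from level \<open>i\<close>.\<close>

text \<open>The exit time is \<open>\<infinity>\<close> if the path never leaves \<open>A\<close> (a null event for finite \<open>A\<close>); such a
  particle leaves the aggregate unchanged, and its trajectory is then the entire path.\<close>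

definition exit_time :: "site set \<Rightarrow> (nat \<Rightarrow> site) \<Rightarrow> enat" where
  "exit_time A X = (INF t \<in> {t. X t \<notin> A}. enat t)"

definition trajectory :: "site set \<Rightarrow> (nat \<Rightarrow> site) \<Rightarrow> site set" where
  "trajectory A X = X ` {t. enat t \<le> exit_time A X}"

definition add_particle :: "site set \<Rightarrow> (nat \<Rightarrow> site) \<Rightarrow> site set" where
  "add_particle A X = A \<union> {X t | t. exit_time A X = enat t}"

fun send_level :: "(int \<Rightarrow> nat \<Rightarrow> nat \<Rightarrow> site) \<Rightarrow> int \<Rightarrow> nat \<Rightarrow> site set \<Rightarrow> site set" where
  "send_level w i 0 A = A"
| "send_level w i (Suc j) A = add_particle (send_level w i j A) (w i (Suc j))"

text \<open>Levels are processed in the order \<open>0, 1, -1, 2, -2, \<dots>, M, -M\<close>.\<close>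

fun aggregate :: "(int \<Rightarrow> nat) \<Rightarrow> (int \<Rightarrow> nat \<Rightarrow> nat \<Rightarrow> site) \<Rightarrow> nat \<Rightarrow> site set" where
  "aggregate c w 0 = send_level w 0 (c 0) {}"
| "aggregate c w (Suc M) =
     send_level w (- int (Suc M)) (c (- int (Suc M)))
       (send_level w (int (Suc M)) (c (int (Suc M))) (aggregate c w M))"

definition aggregate_inf :: "(int \<Rightarrow> nat) \<Rightarrow> (int \<Rightarrow> nat \<Rightarrow> nat \<Rightarrow> site) \<Rightarrow> site set" where
  "aggregate_inf c w = (\<Union>M. aggregate c w M)"

text \<open>The aggregate just before the first particle of level \<open>i\<close>, resp. just before particle
  \<open>(i, j)\<close>, is sent. It does not depend on \<open>M \<ge> \<bar>i\<bar>\<close>, the construction being nested in \<open>M\<close>.\<close>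

definition aggregate_before_level ::
    "(int \<Rightarrow> nat) \<Rightarrow> (int \<Rightarrow> nat \<Rightarrow> nat \<Rightarrow> site) \<Rightarrow> int \<Rightarrow> site set" where
  "aggregate_before_level c w i =
     (if i = 0 then {}
      else if i > 0 then aggregate c w (nat i - 1)
      else send_level w (- i) (c (- i)) (aggregate c w (nat (- i) - 1)))"

definition aggregate_before ::
    "(int \<Rightarrow> nat) \<Rightarrow> (int \<Rightarrow> nat \<Rightarrow> nat \<Rightarrow> site) \<Rightarrow> int \<Rightarrow> nat \<Rightarrow> site set" where
  "aggregate_before c w i j = send_level w i (j - 1) (aggregate_before_level c w i)"

definition particle_trajectory ::
    "(int \<Rightarrow> nat) \<Rightarrow> (int \<Rightarrow> nat \<Rightarrow> nat \<Rightarrow> site) \<Rightarrow> int \<Rightarrow> nat \<Rightarrow> site set" where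
  "particle_trajectory c w i j = trajectory (aggregate_before c w i j) (w i j)"

definition particles :: "(int \<Rightarrow> nat) \<Rightarrow> nat \<Rightarrow> (int \<times> nat) set" where
  "particles c M = {(i, j). \<bar>i\<bar> \<le> int M \<and> 1 \<le> j \<and> j \<le> c i}"

text \<open>The particles contributing to the infinite aggregate are all those sent at some stage of
  its construction; see \<open>aggregate_inf_eq\<close> below.\<close>

definition contributing_particles :: "(int \<Rightarrow> nat) \<Rightarrow> (int \<times> nat) set" where
  "contributing_particles c = (\<Union>M. particles c M)"

definition strip :: "nat \<Rightarrow> site set" where
  "strip M = UNIV \<times> {- int M .. int M}"

lemma send_level_eq:
  "send_level w i m A =
     A \<union> {w i j t | j t. 1 \<le> j \<and> j \<le> m \<and> exit_time (send_level w i (j - 1) A) (w i j) = enat t}"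
proof (induction m)
  case 0
  then show ?case by auto
next
  case (Suc m)
  have "send_level w i (Suc m) A =
      send_level w i m A \<union> {w i (Suc m) t | t. exit_time (send_level w i m A) (w i (Suc m)) = enat t}"
    by (simp add: add_particle_def)
  also have "\<dots> = A \<union> {w i j t | j t. 1 \<le> j \<and> j \<le> m \<and>
        exit_time (send_level w i (j - 1) A) (w i j) = enat t}
      \<union> {w i (Suc m) t | t. exit_time (send_level w i m A) (w i (Suc m)) = enat t}"
    by (subst Suc.IH) (rule refl)
  also have "\<dots> = A \<union> {w i j t | j t. 1 \<le> j \<and> j \<le> Suc m \<and>
        exit_time (send_level w i (j - 1) A) (w i j) = enat t}"
  proof -
    have "1 \<le> j \<and> j \<le> Suc m \<longleftrightarrow> 1 \<le> j \<and> j \<le> m \<or> j = Suc m" for j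
      by auto
    then have "{w i j t | j t. 1 \<le> j \<and> j \<le> Suc m \<and> Q j t} =
        {w i j t | j t. 1 \<le> j \<and> j \<le> m \<and> Q j t} \<union> {w i (Suc m) t | t. Q (Suc m) t}" for Q
      by blast
    from this[of "\<lambda>j t. exit_time (send_level w i (j - 1) A) (w i j) = enat t"]
    show ?thesis by (simp add: Un_assoc)
  qed
  finally show ?case .
qed

lemma aggregate_eq:
  "aggregate c w M =
     {w i j t | i j t. (i, j) \<in> particles c M \<and> exit_time (aggregate_before c w i j) (w i j) = enat t}"
proof (induction M)
  case 0
  show ?case
    by (subst aggregate.simps, subst send_level_eq)
      (auto simp: particles_def aggregate_before_def aggregate_before_level_def)
next
  case (Suc M)
  let ?T = "\<lambda>i. {w i j t | j t. 1 \<le> j \<and> j \<le> c i \<and>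
      exit_time (aggregate_before c w i j) (w i j) = enat t}"
  have up: "aggregate_before_level c w (int (Suc M)) = aggregate c w M"
    by (simp add: aggregate_before_level_def nat_add_distrib)
  have dn: "aggregate_before_level c w (- int (Suc M)) =
      send_level w (int (Suc M)) (c (int (Suc M))) (aggregate c w M)"
    by (simp add: aggregate_before_level_def nat_add_distrib add.commute)
  have step: "send_level w i (c i) (aggregate_before_level c w i) =
      aggregate_before_level c w i \<union> ?T i" for i
    by (subst send_level_eq) (simp add: aggregate_before_def)
  have "aggregate c w (Suc M) = aggregate c w M \<union> ?T (int (Suc M)) \<union> ?T (- int (Suc M))"
    using step[of "int (Suc M)"] step[of "- int (Suc M)"] unfolding up dn by simp
  moreover have "(i, j) \<in> particles c (Suc M) \<longleftrightarrow>
      (i, j) \<in> particles c M \<or> (i = int (Suc M) \<or> i = - int (Suc M)) \<and> 1 \<le> j \<and> j \<le> c i" for i j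
    by (auto simp: particles_def)
  ultimately show ?case
    unfolding Suc.IH by blast
qed

lemma aggregate_inf_eq:
  "aggregate_inf c w =
     {w i j t | i j t. (i, j) \<in> contributing_particles c \<and>
        exit_time (aggregate_before c w i j) (w i j) = enat t}"
  unfolding aggregate_inf_def aggregate_eq contributing_particles_def by blast

section \<open>The random input\<close>

definition simple_random_walk ::
    "'w measure \<Rightarrow> site \<Rightarrow> (nat \<Rightarrow> 'w \<Rightarrow> site) \<Rightarrow> bool" where
  "simple_random_walk P x X \<longleftrightarrow>
     (\<forall>\<omega>\<in>space P. X 0 \<omega> = x) \<and>
     prob_space.indep_vars P (\<lambda>_. count_space UNIV) (\<lambda>t \<omega>. X (Suc t) \<omega> - X t \<omega>) UNIV \<and>
     (\<forall>t. distr P (count_space UNIV) (\<lambda>\<omega>. X (Suc t) \<omega> - X t \<omega>) =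
        measure_pmf (pmf_of_set {(1, 0), (-1, 0), (0, 1), (0, -1)}))"

abbreviation path_space :: "(nat \<Rightarrow> site) measure" where
  "path_space \<equiv> PiM UNIV (\<lambda>_. count_space UNIV)"

abbreviation walk_index :: "(int \<times> nat) set" where
  "walk_index \<equiv> UNIV \<times> {1..}"

definition walk_family :: "'w measure \<Rightarrow> (int \<Rightarrow> nat \<Rightarrow> nat \<Rightarrow> 'w \<Rightarrow> site) \<Rightarrow> bool" where
  "walk_family P S \<longleftrightarrow>
     (\<forall>i. \<forall>j\<ge>1. simple_random_walk P (0, i) (S i j)) \<and>
     prob_space.indep_vars P (\<lambda>_. path_space) (\<lambda>(i, j) \<omega> t. S i j t \<omega>) walk_index"

text \<open>Independence of the counts from the walks is independence of the generated
  sigma-algebras (\<open>indep_var\<close> would require both variables to have the same value type).\<close>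

definition poisson_counts ::
    "'w measure \<Rightarrow> (int \<Rightarrow> nat \<Rightarrow> nat \<Rightarrow> 'w \<Rightarrow> site) \<Rightarrow> real \<Rightarrow> (int \<Rightarrow> 'w \<Rightarrow> nat) \<Rightarrow> bool" where
  "poisson_counts P S r N \<longleftrightarrow>
     prob_space.indep_vars P (\<lambda>_. count_space UNIV) N UNIV \<and>
     (\<forall>i. distr P (count_space UNIV) (N i) = measure_pmf (poisson_pmf r)) \<and>
     prob_space.indep_set P
       (sets (vimage_algebra (space P) (\<lambda>\<omega> i. N i \<omega>) (PiM UNIV (\<lambda>_. count_space UNIV))))
       (sets (vimage_algebra (space P) (\<lambda>\<omega>. \<lambda>(i, j)\<in>walk_index. \<lambda>t. S i j t \<omega>)
          (PiM walk_index (\<lambda>_. path_space))))"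

end

theory Submission
  imports Defs "HOL-Real_Asymp.Real_Asymp"
begin

text \<open>When particle \<open>(i, j)\<close> is sent, the aggregate has at most \<open>K \<bar>i\<bar>\<close> sites, so at least
  \<open>\<bar>i\<bar> / 4\<close> of the rows between heights \<open>\<bar>i\<bar> / 2\<close> and \<open>\<bar>i\<bar>\<close> contain at most \<open>4 K\<close> of its
  sites. Whenever the walk first enters such a thin row, \<open>4 K\<close> consecutive steps to the right would
  take it out of the aggregate, and they occur with probability \<open>(1 / 4) ^ (4 * K)\<close>. As the aggregate
  is independent of the walk, the particle reaches height \<open>\<bar>i\<bar> / 2\<close> with probability
  exponentially small in \<open>\<bar>i\<bar>\<close>. Borel--Cantelli over the at most \<open>2 K m\<close> particles with
  \<open>\<bar>i\<bar> = m\<close> leaves finitely many exceptional levels, and \<open>\<bar>i\<bar> > M powr \<alpha>\<close> implies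
  \<open>M \<le> \<bar>i\<bar> / 2\<close> for large \<open>M\<close>. For Poisson counts the linear bound on the number of particles
  is a Chernoff estimate.\<close>

section \<open>Deterministic properties of the aggregate\<close>

text \<open>The site at time \<open>t\<close> itself need not lie in \<open>A\<close>, so the exit
  site counts as visited, as it does in \<open>trajectory\<close>. Paths that never leave
  \<open>A\<close> need no separate treatment.\<close>

definition visits :: "site set \<Rightarrow> site set \<Rightarrow> (nat \<Rightarrow> site) \<Rightarrow> bool" where
  "visits A H X \<longleftrightarrow> (\<exists>t. X t \<in> H \<and> (\<forall>s<t. X s \<in> A))"

lemma enat_le_exit_time_iff: "enat t \<le> exit_time A X \<longleftrightarrow> (\<forall>s<t. X s \<in> A)"
  by (auto simp: exit_time_def le_INF_iff) (meson not_le)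

lemma trajectory_Int_eq_empty_iff: "trajectory A X \<inter> H = {} \<longleftrightarrow> \<not> visits A H X"
  by (auto simp: trajectory_def visits_def enat_le_exit_time_iff)

lemma exit_time_eq_enat_iff: "exit_time A X = enat t \<longleftrightarrow> X t \<notin> A \<and> (\<forall>s<t. X s \<in> A)"
  (is "?l \<longleftrightarrow> ?r")
proof
  assume l: ?l
  then have "\<not> enat (Suc t) \<le> exit_time A X" by simp
  moreover have "enat t \<le> exit_time A X" using l by simp
  ultimately show ?r
    unfolding enat_le_exit_time_iff by (metis less_Suc_eq)
next
  assume r: ?r
  then have "exit_time A X \<le> enat t"
    by (auto simp: exit_time_def intro: INF_lower)
  moreover have "enat t \<le> exit_time A X"
    using r by (simp add: enat_le_exit_time_iff)
  ultimately show ?l by simp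
qed

text \<open>This form serves measurability: \<open>LEAST\<close> of measurable predicates is
  measurable, and the added site is one coordinate of the path at a countably valued time.\<close>

lemma add_particle_eq:
  "add_particle A X = (if \<exists>t. X t \<notin> A then insert (X (LEAST t. X t \<notin> A)) A else A)"
proof (cases "\<exists>t. X t \<notin> A")
  case True
  then have "exit_time A X = enat (LEAST t. X t \<notin> A)"
    unfolding exit_time_eq_enat_iff using LeastI_ex[OF True] not_less_Least by blast
  with True show ?thesis by (auto simp: add_particle_def)
qed (auto simp: add_particle_def exit_time_eq_enat_iff)

lemma send_level_finite_card:
  assumes "finite A"
  shows "finite (send_level w i m A) \<and> card (send_level w i m A) \<le> card A + m"
proof (induction m)
  case (Suc m)
  then show ?case by (auto simp: add_particle_eq card_insert_if)
qed (use assms in simp)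

lemma aggregate_finite_card:
  "finite (aggregate c w M) \<and> card (aggregate c w M) \<le> (\<Sum>k\<in>{-int M..int M}. c k)"
proof (induction M)
  case 0
  then show ?case using send_level_finite_card[of "{}" w 0 "c 0"] by simp
next
  case (Suc M)
  have "{-int (Suc M)..int (Suc M)} = insert (int (Suc M)) (insert (- int (Suc M)) {-int M..int M})"
    by auto
  then have "(\<Sum>k\<in>{-int (Suc M)..int (Suc M)}. c k) =
      c (int (Suc M)) + (c (- int (Suc M)) + (\<Sum>k\<in>{-int M..int M}. c k))"
    by simp
  moreover have "finite (send_level w k m A) \<and> card (send_level w k m A) \<le> C + m"
    if "finite A \<and> card A \<le> C" for k m A C
    using that send_level_finite_card[of A w k m] by linarith
  from this[OF this[OF Suc.IH]] have "finite (aggregate c w (Suc M)) \<and>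
      card (aggregate c w (Suc M)) \<le> (\<Sum>k\<in>{-int M..int M}. c k) + c (int (Suc M)) + c (- int (Suc M))"
    by (simp only: aggregate.simps)
  ultimately show ?case by linarith
qed

lemma finite_aggregate_before: "finite (aggregate_before c w i j)"
  unfolding aggregate_before_def aggregate_before_level_def
  by (simp add: send_level_finite_card aggregate_finite_card)

text \<open>Each particle adds at most one site, and all particles sent before \<open>(i, j)\<close>
  come from levels of absolute value at most \<bar>i\<bar>. On level \<open>i\<close> itself there
  are fewer than \<open>c i\<close> of them or none.\<close>

lemma card_aggregate_before_le:
  assumes "j \<le> c i"
  shows "card (aggregate_before c w i j) \<le> (\<Sum>k\<in>{-\<bar>i\<bar>..\<bar>i\<bar>}. c k)"
proof -
  have *: "card (aggregate_before c w i j) \<le> card (aggregate_before_level c w i) + c i"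
    if "finite (aggregate_before_level c w i)"
    using send_level_finite_card[OF that, of w i "j - 1"] assms
    unfolding aggregate_before_def by linarith
  consider "i = 0" | "i > 0" | "i < 0" by linarith
  then show ?thesis
  proof cases
    case 1
    then show ?thesis using * by (simp add: aggregate_before_level_def)
  next
    case 2
    have "(\<Sum>k\<in>insert i {-int (nat i - 1)..int (nat i - 1)}. c k) \<le> (\<Sum>k\<in>{-\<bar>i\<bar>..\<bar>i\<bar>}. c k)"
      using 2 by (intro sum_mono2) auto
    then show ?thesis
      using * 2 aggregate_finite_card[of c w "nat i - 1"]
      by (simp add: aggregate_before_level_def)
  next
    \<comment> \<open>For negative \<open>i\<close> two levels of absolute value \<bar>i\<bar>
      contribute: \<open>-i\<close> has been completed and \<open>i\<close> is in progress.\<close>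
    case 3
    have "(\<Sum>k\<in>insert i (insert (-i) {-int (nat (-i) - 1)..int (nat (-i) - 1)}). c k) 
        \<le> (\<Sum>k\<in>{-\<bar>i\<bar>..\<bar>i\<bar>}. c k)"
      using 3 by (intro sum_mono2) auto
    then show ?thesis
      using * 3 aggregate_finite_card[of c w "nat (-i) - 1"]
        send_level_finite_card[of "aggregate c w (nat (-i) - 1)" w "-i" "c (-i)"]
      by (simp add: aggregate_before_level_def)
  qed
qed

lemma send_level_cong:
  assumes "\<And>l. 1 \<le> l \<Longrightarrow> l \<le> m \<Longrightarrow> w k l = w' k l"
  shows "send_level w k m A = send_level w' k m A"
  using assms by (induction m) auto

lemma aggregate_cong:
  assumes "\<And>k. \<bar>k\<bar> \<le> int M \<Longrightarrow> c k = c' k"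
    and "\<And>k l. \<bar>k\<bar> \<le> int M \<Longrightarrow> 1 \<le> l \<Longrightarrow> w k l = w' k l"
  shows "aggregate c w M = aggregate c' w' M"
  using assms
proof (induction M)
  case 0
  then show ?case by simp (rule send_level_cong, simp)
next
  case (Suc M)
  have "aggregate c w M = aggregate c' w' M" by (rule Suc.IH) (simp_all add: Suc.prems)
  moreover have "send_level w k (c k) A = send_level w' k (c' k) A" if "\<bar>k\<bar> \<le> int (Suc M)" for k A
    unfolding Suc.prems(1)[OF that] by (rule send_level_cong) (simp add: Suc.prems(2)[OF that])
  ultimately show ?case by simp
qed

text \<open>All sites come from particles sent earlier, so the aggregate is a function of the other
  walks and of the counts up to level \<bar>i\<bar>. This gives its independence of the walk
  \<open>(i, j)\<close> and allows random counts to be replaced by a fixed vector.\<close>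

lemma aggregate_before_cong:
  assumes c: "\<And>k. \<bar>k\<bar> \<le> \<bar>i\<bar> \<Longrightarrow> c k = c' k"
    and w: "\<And>k l. (k, l) \<noteq> (i, j) \<Longrightarrow> 1 \<le> l \<Longrightarrow> w k l = w' k l"
  shows "aggregate_before c w i j = aggregate_before c' w' i j"
proof -
  have agg: "aggregate c w m = aggregate c' w' m" if "int m < \<bar>i\<bar>" for m
    using that by (intro aggregate_cong c w) auto
  have "send_level w (-i) (c (-i)) A = send_level w' (-i) (c' (-i)) A" if "i < 0" for A
    using that by (subst c) (auto intro!: send_level_cong w)
  then have "aggregate_before_level c w i = aggregate_before_level c' w' i"
    by (auto simp: aggregate_before_level_def agg)
  moreover have "send_level w i (j - 1) A = send_level w' i (j - 1) A" for A
    by (intro send_level_cong w) auto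
  ultimately show ?thesis by (simp add: aggregate_before_def)
qed

section \<open>Measurability\<close>

text \<open>There are only countably many finite site sets, so a measurable map into this space can
  be treated one value at a time.\<close>

abbreviation finite_sites :: "site set measure" where
  "finite_sites \<equiv> count_space {A. finite A}"

lemma countable_finite_sites: "countable {A :: site set. finite A}"
  by (rule countable_Collect_finite)

lemma pred_path_component [measurable]:
  "Measurable.pred path_space (\<lambda>X :: nat \<Rightarrow> site. X t \<in> A)"
proof -
  have "(\<lambda>X :: nat \<Rightarrow> site. X t) \<in> path_space \<rightarrow>\<^sub>M count_space UNIV" by measurable
  from measurable_compose[OF this, of "\<lambda>x. x \<in> A" "count_space UNIV"] show ?thesis by simp
qed

lemma pred_visits [measurable]: "Measurable.pred path_space (visits A H)"
  unfolding visits_def[abs_def] by measurable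

lemma measurable_add_particle:
  assumes "finite A"
  shows "add_particle A \<in> path_space \<rightarrow>\<^sub>M finite_sites"
proof -
  have L: "(\<lambda>X. LEAST t. X t \<notin> A) \<in> path_space \<rightarrow>\<^sub>M count_space UNIV"
    by (rule measurable_Least) measurable
  have "(\<lambda>X. insert (X (LEAST t. X t \<notin> A)) A) \<in> path_space \<rightarrow>\<^sub>M finite_sites"
  proof (rule measurable_compose_countable'[OF _ L])
    fix t :: nat
    have "(\<lambda>X :: nat \<Rightarrow> site. X t) \<in> path_space \<rightarrow>\<^sub>M count_space UNIV" by measurable
    from measurable_compose[OF this, of "\<lambda>x. insert x A" finite_sites]
    show "(\<lambda>X. insert (X t) A) \<in> path_space \<rightarrow>\<^sub>M finite_sites" using assms by simp
  qed auto
  moreover have "(\<lambda>X. A) \<in> path_space \<rightarrow>\<^sub>M finite_sites" using assms by simp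
  ultimately show ?thesis
    unfolding add_particle_eq[abs_def] by (rule measurable_If) (unfold pred_def[symmetric], measurable)
qed

lemma measurable_send_level:
  assumes "f \<in> M \<rightarrow>\<^sub>M finite_sites"
    and "\<And>l. 1 \<le> l \<Longrightarrow> l \<le> m \<Longrightarrow> (\<lambda>x. w x k l) \<in> M \<rightarrow>\<^sub>M path_space"
  shows "(\<lambda>x. send_level (w x) k m (f x)) \<in> M \<rightarrow>\<^sub>M finite_sites"
  using assms(2)
proof (induction m)
  case (Suc m)
  have "(\<lambda>x. add_particle (send_level (w x) k m (f x)) (w x k (Suc m))) \<in> M \<rightarrow>\<^sub>M finite_sites"
  \<comment> \<open>With the previous aggregate frozen at one of its countably many values, only the
    walk of the next particle remains.\<close>
  proof (rule measurable_compose_countable'[where g = "\<lambda>x. send_level (w x) k m (f x)" and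
        f = "\<lambda>A x. add_particle A (w x k (Suc m))"])
    fix A :: "site set" assume "A \<in> {A. finite A}"
    then show "(\<lambda>x. add_particle A (w x k (Suc m))) \<in> M \<rightarrow>\<^sub>M finite_sites"
      by (intro measurable_compose[OF _ measurable_add_particle] Suc.prems) auto
  qed (use Suc countable_finite_sites in auto)
  then show ?case by simp
qed (use assms in simp)

lemma measurable_aggregate:
  assumes "\<And>k l. \<bar>k\<bar> \<le> int m \<Longrightarrow> 1 \<le> l \<Longrightarrow> (\<lambda>x. w x k l) \<in> M \<rightarrow>\<^sub>M path_space"
  shows "(\<lambda>x. aggregate c (w x) m) \<in> M \<rightarrow>\<^sub>M finite_sites"
  using assms
proof (induction m)
  case 0
  then show ?case by (auto intro!: measurable_send_level)
next
  case (Suc m)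
  then show ?case
    unfolding aggregate.simps by (intro measurable_send_level) auto
qed

lemma measurable_aggregate_before:
  assumes "\<And>k l. (k, l) \<noteq> (i, j) \<Longrightarrow> 1 \<le> l \<Longrightarrow> (\<lambda>x. w x k l) \<in> M \<rightarrow>\<^sub>M path_space"
  shows "(\<lambda>x. aggregate_before c (w x) i j) \<in> M \<rightarrow>\<^sub>M finite_sites"
proof -
  have agg: "(\<lambda>x. aggregate c (w x) m) \<in> M \<rightarrow>\<^sub>M finite_sites" if "int m < \<bar>i\<bar>" for m
    using that by (intro measurable_aggregate assms) auto
  consider "i = 0" | "i > 0" | "i < 0" by linarith
  then have "(\<lambda>x. aggregate_before_level c (w x) i) \<in> M \<rightarrow>\<^sub>M finite_sites"
  proof cases
    case 3
    then show ?thesis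
      by (auto simp: aggregate_before_level_def intro!: measurable_send_level agg assms)
  qed (auto simp: aggregate_before_level_def intro!: agg)
  then show ?thesis
    unfolding aggregate_before_def by (intro measurable_send_level assms) auto
qed

section \<open>Escape of a single walk from a fixed set\<close>

abbreviation nn_steps :: "site set" where
  "nn_steps \<equiv> {(1, 0), (-1, 0), (0, 1), (0, -1)}"

text \<open>Paths are encoded by their increments, so that finite-horizon events can be counted.
  Membership in \<open>H\<close> is tested before membership in \<open>A\<close>: once
  \<open>H\<close> is reached, the remaining steps are free.\<close>

fun hits :: "site set \<Rightarrow> site set \<Rightarrow> site \<Rightarrow> site list \<Rightarrow> bool" where
  "hits A H x [] \<longleftrightarrow> x \<in> H"
| "hits A H x (e # es) \<longleftrightarrow> x \<in> H \<or> x \<in> A \<and> hits A H (x + e) es"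

lemma hits_increments_iff:
  "hits A H (X 0) (map (\<lambda>t. X (Suc t) - X t) [0..<T]) \<longleftrightarrow> (\<exists>t\<le>T. X t \<in> H \<and> (\<forall>s<t. X s \<in> A))"
proof (induction T arbitrary: X)
  case (Suc T)
  have "hits A H (X 0) (map (\<lambda>t. X (Suc t) - X t) [0..<Suc T]) \<longleftrightarrow>
      X 0 \<in> H \<or> X 0 \<in> A \<and> (\<exists>t\<le>T. X (Suc t) \<in> H \<and> (\<forall>s<t. X (Suc s) \<in> A))"
    using Suc.IH[of "\<lambda>t. X (Suc t)"] by (simp add: map_upt_Suc del: upt_Suc)
  also have "\<dots> \<longleftrightarrow> (\<exists>t\<le>Suc T. X t \<in> H \<and> (\<forall>s<t. X s \<in> A))" (is "?l \<longleftrightarrow> ?r")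
  proof
    assume ?l
    then show ?r
      by (metis less_Suc_eq_0_disj not_less_zero Suc_le_mono le0)
  next
    assume ?r
    then obtain t where t: "t \<le> Suc T" "X t \<in> H" "\<forall>s<t. X s \<in> A" by blast
    then show ?l by (cases t) auto
  qed
  finally show ?case .
qed simp

text \<open>Induction on the number of steps, splitting off the first one: by \<open>super\<close>,
  averaging \<open>g\<close> over the neighbours does not increase it. Divided by
  \<open>4 ^ T\<close> the count is a probability, so this is the optional stopping bound for a
  supermartingale in finite form.\<close>

lemma card_hits_le:
  fixes g :: "site \<Rightarrow> real"
  assumes nonneg: "\<And>x. 0 \<le> g x"
    and target: "\<And>x. x \<in> H \<Longrightarrow> 1 \<le> g x"
    and super: "\<And>x. x \<in> A - H \<Longrightarrow> (\<Sum>e\<in>nn_steps. g (x + e)) \<le> 4 * g x"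
  shows "real (card {es. set es \<subseteq> nn_steps \<and> length es = T \<and> hits A H x es}) \<le> 4 ^ T * g x"
proof (induction T arbitrary: x)
  case 0
  have "{es. set es \<subseteq> nn_steps \<and> length es = 0 \<and> hits A H x es} = (if x \<in> H then {[]} else {})"
    by auto
  then show ?case using nonneg target by auto
next
  case (Suc T)
  let ?G = "\<lambda>T x. {es. set es \<subseteq> nn_steps \<and> length es = T \<and> hits A H x es}"
  have fin: "finite {es. set es \<subseteq> nn_steps \<and> length es = T'}" for T'
    by (rule finite_lists_length_eq) simp
  consider "x \<in> H" | "x \<notin> H" "x \<notin> A" | "x \<in> A - H" by blast
  then show ?case
  proof cases
    case 1
    \<comment> \<open>From a point of \<open>H\<close> every list counts, and
      \<open>1 \<le> g x\<close> absorbs all \<open>4 ^ Suc T\<close> of them.\<close>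
    have "card (?G (Suc T) x) \<le> card {es. set es \<subseteq> nn_steps \<and> length es = Suc T}"
      by (rule card_mono[OF fin]) auto
    also have "\<dots> = card nn_steps ^ Suc T"
      by (rule card_lists_length_eq) simp
    also have "card nn_steps = 4" by simp
    finally have "real (card (?G (Suc T) x)) \<le> real (4 ^ Suc T)"
      by (rule of_nat_mono)
    also have "real (4 ^ Suc T) = 4 ^ Suc T" by simp
    also have "\<dots> \<le> 4 ^ Suc T * g x"
      using target[OF 1] by simp
    finally show ?thesis .
  next
    case 2
    then have "\<not> hits A H x es" if "length es = Suc T" for es
      using that by (cases es) auto
    then have "?G (Suc T) x = {}" by blast
    then show ?thesis using nonneg[of x] by (simp only: card.empty) simp
  next
    case 3
    have "?G (Suc T) x \<subseteq> (\<Union>e\<in>nn_steps. (#) e ` ?G T (x + e))"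
    proof
      fix es assume es: "es \<in> ?G (Suc T) x"
      then obtain e es' where e: "es = e # es'" by (cases es) auto
      have "e \<in> nn_steps" "set es' \<subseteq> nn_steps"
        using es unfolding e by (simp_all only: mem_Collect_eq list.set insert_subset)
      moreover have "length es' = T" "hits A H (x + e) es'"
        using es 3 unfolding e by simp_all
      ultimately have "es' \<in> ?G T (x + e)" by blast
      then show "es \<in> (\<Union>e\<in>nn_steps. (#) e ` ?G T (x + e))"
        unfolding e by (intro UN_I[OF \<open>e \<in> nn_steps\<close>] image_eqI[OF refl])
    qed
    then have "card (?G (Suc T) x) \<le> card (\<Union>e\<in>nn_steps. (#) e ` ?G T (x + e))"
      by (rule card_mono[rotated]) (intro finite_UN_I finite_imageI finite_subset[OF _ fin[of T]]; auto)
    also have "\<dots> \<le> (\<Sum>e\<in>nn_steps. card ((#) e ` ?G T (x + e)))"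
      by (rule card_UN_le) simp
    also have "\<dots> \<le> (\<Sum>e\<in>nn_steps. card (?G T (x + e)))"
      by (intro sum_mono card_image_le finite_subset[OF _ fin[of T]]) auto
    finally have "real (card (?G (Suc T) x)) \<le> (\<Sum>e\<in>nn_steps. real (card (?G T (x + e))))"
      unfolding of_nat_sum[symmetric] by (rule of_nat_mono)
    also have "\<dots> \<le> (\<Sum>e\<in>nn_steps. 4 ^ T * g (x + e))"
      by (rule sum_mono) (rule Suc.IH)
    also have "\<dots> = 4 ^ T * (\<Sum>e\<in>nn_steps. g (x + e))"
      by (rule sum_distrib_left[symmetric])
    also have "\<dots> \<le> 4 ^ T * (4 * g x)"
      using super[OF 3] by (intro mult_left_mono) auto
    finally show ?thesis by (simp add: mult.assoc mult.left_commute)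
  qed
qed

text \<open>The function \<open>g\<close> encodes the escape to the right without any stopping time: it drops by a
  factor \<open>q\<close> at every thin row, and inside a thin row it is reduced by the factor
  \<open>1 - (1 / 4) ^ r\<close>, where \<open>r\<close> is the number of steps to the right needed to leave \<open>B\<close>. The sign
  \<open>s\<close> treats walks coming from above and from below at once.\<close>

lemma ex_supersolution:
  fixes B :: "site set" and s h :: int and w :: nat
  assumes B: "finite B" and s: "s = 1 \<or> s = -1"
  defines "thin \<equiv> \<lambda>k. card (B \<inter> UNIV \<times> {s * k}) \<le> w"
  defines "q \<equiv> 1 - (1 / 4 :: real) ^ w"
  shows "\<exists>g :: site \<Rightarrow> real.
    (\<forall>x. 0 \<le> g x) \<and>
    (\<forall>x. s * snd x \<le> h \<longrightarrow> 1 \<le> g x) \<and>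
    (\<forall>x\<in>B. s * snd x > h \<longrightarrow> (\<Sum>e\<in>nn_steps. g (x + e)) \<le> 4 * g x) \<and>
    (\<forall>x. g x \<le> q ^ card {k \<in> {h<..s * snd x}. thin k})"
proof -
  define \<theta> where "\<theta> l = card {k \<in> {h<..l}. thin k}" for l
  define r where "r x = (LEAST r. (fst x + int r, snd x) \<notin> B)" for x :: site
  \<comment> \<open>In a thin row beyond \<open>h\<close>, sites outside \<open>B\<close> have
    \<open>r x = 0\<close> and hence value 0: a walk that gets there has escaped. Inside
    \<open>B\<close> the value decreases towards the exit on the right.\<close>
  define g where "g x = (if s * snd x \<le> h then 1
      else if thin (s * snd x) then q ^ \<theta> (s * snd x - 1) * (1 - (1/4) ^ r x)
      else q ^ \<theta> (s * snd x))" for x :: site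
  have q: "0 \<le> q" "q \<le> 1" by (auto simp: q_def power_le_one)
  have \<theta>_mono: "\<theta> l \<le> \<theta> l'" if "l \<le> l'" for l l'
    unfolding \<theta>_def using that by (intro card_mono finite_Collect_conjI disjI1) auto
  have \<theta>_le: "\<theta> l = 0" if "l \<le> h" for l
    using that by (simp add: \<theta>_def)
  have \<theta>_thin: "\<theta> l = Suc (\<theta> (l - 1))" if "h < l" "thin l" for l
  proof -
    have "{k \<in> {h<..l}. thin k} = insert l {k \<in> {h<..l - 1}. thin k}"
      using that by auto
    moreover have "finite {k \<in> {h<..l - 1}. thin k}"
      by (rule finite_subset[of _ "{h<..l - 1}"]) auto
    ultimately show ?thesis by (simp add: \<theta>_def)
  qed
  have \<theta>_thick: "\<theta> l = \<theta> (l - 1)" if "\<not> thin l" for l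
  proof -
    have "k \<noteq> l" if "thin k" for k using that \<open>\<not> thin l\<close> by blast
    then have "{k \<in> {h<..l}. thin k} = {k \<in> {h<..l - 1}. thin k}"
      by (auto simp: order_le_less)
    then show ?thesis by (simp add: \<theta>_def)
  qed
  have ex_r: "\<exists>r. (a + int r, y) \<notin> B" for a y
  proof (rule ccontr)
    assume "\<nexists>r. (a + int r, y) \<notin> B"
    then have "range (\<lambda>r. (a + int r, y)) \<subseteq> B" by auto
    moreover have "infinite (range (\<lambda>r. (a + int r, y)))"
      by (intro range_inj_infinite) (auto simp: inj_def)
    ultimately show False using B finite_subset by blast
  qed
  \<comment> \<open>The \<open>r x\<close> sites from \<open>x\<close> rightwards before the exit
    are distinct members of \<open>B\<close> in one row.\<close>
  have r_le: "r x \<le> card (B \<inter> UNIV \<times> {snd x})" for x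
  proof -
    have "(\<lambda>t. (fst x + int t, snd x)) ` {..<r x} \<subseteq> B \<inter> UNIV \<times> {snd x}"
      unfolding r_def using not_less_Least by blast
    then have "card ((\<lambda>t. (fst x + int t, snd x)) ` {..<r x}) \<le> card (B \<inter> UNIV \<times> {snd x})"
      using B by (intro card_mono) auto
    then show ?thesis by (subst (asm) card_image) (auto simp: inj_on_def)
  qed
  have r_Suc: "r (a, y) = Suc (r (a + 1, y))" if "(a, y) \<in> B" for a y
  proof -
    obtain n where n: "(a + int n, y) \<notin> B" using ex_r by blast
    have "(LEAST n. (a + int n, y) \<notin> B) = Suc (LEAST m. (a + int (Suc m), y) \<notin> B)"
      using that by (intro Least_Suc[of "\<lambda>n. (a + int n, y) \<notin> B", OF n]) auto
    then show ?thesis by (simp add: r_def algebra_simps)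
  qed
  have ss: "s * (s * y) = y" for y using s by auto
  have g_le: "g x \<le> q ^ \<theta> (s * snd x)" for x
  proof -
    \<comment> \<open>Since \<open>r x \<le> w\<close> in a thin row, the factor there is at most
      \<open>q\<close>, which pays for the increase of \<theta> by one at this row.\<close>
    have "1 - (1/4) ^ r x \<le> q" if "thin (s * snd x)"
    proof -
      have "r x \<le> w" using r_le[of x] that by (simp add: thin_def ss)
      then show ?thesis by (simp add: q_def power_decreasing)
    qed
    then show ?thesis
      using q \<theta>_thin[of "s * snd x"] \<theta>_le[of "s * snd x"]
      by (auto simp: g_def mult.commute[of q] intro!: mult_left_mono)
  qed
  have g_le': "g x \<le> q ^ \<theta> l" if "l \<le> s * snd x" for x l
    using g_le[of x] power_decreasing[OF \<theta>_mono[OF that] q] by linarith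
  show ?thesis
  proof (intro exI[of _ g] conjI allI ballI impI)
    show "0 \<le> g x" for x
      using q by (auto simp: g_def intro!: mult_nonneg_nonneg power_le_one)
    show "1 \<le> g x" if "s * snd x \<le> h" for x using that by (simp add: g_def)
    show "g x \<le> q ^ card {k \<in> {h<..s * snd x}. thin k}" for x
      using g_le[of x] by (simp add: \<theta>_def)
    show "(\<Sum>e\<in>nn_steps. g (x + e)) \<le> 4 * g x" if x: "x \<in> B" "s * snd x > h" for x
    proof -
      obtain a y where [simp]: "x = (a, y)" by (cases x)
      define Q where "Q = q ^ \<theta> (s * y - 1)"
      have sum: "(\<Sum>e\<in>nn_steps. g (x + e)) = g (a + 1, y) + g (a - 1, y) + g (a, y + 1) + g (a, y - 1)"
        by simp
      \<comment> \<open>All four neighbours have signed height at least \<open>s * y - 1\<close>,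
        and \<open>q ^ \<theta> l\<close> is nonincreasing in \<open>l\<close>, so \<open>Q\<close>
        bounds them all.\<close>
      have nb: "g (a - 1, y) \<le> Q" "g (a, y + 1) \<le> Q" "g (a, y - 1) \<le> Q" "g (a + 1, y) \<le> Q"
        unfolding Q_def by (rule g_le'; use s in auto)+
      show ?thesis
      proof (cases "thin (s * y)")
        case True
        \<comment> \<open>The exit is one step further from \<open>a\<close> than from
          \<open>a + 1\<close>. Averaging three values \<open>Q\<close> with the value at the right
          neighbour therefore gives exactly \<open>g x\<close>.\<close>
        have "g x = Q * (1 - (1/4) ^ r (a + 1, y) / 4)" "g (a + 1, y) = Q * (1 - (1/4) ^ r (a + 1, y))"
          using x True r_Suc[of a y] by (simp_all add: g_def Q_def)
        then have "4 * g x = 3 * Q + g (a + 1, y)" by (simp add: algebra_simps)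
        then show ?thesis using sum nb by linarith
      next
        case False
        then have "g x = Q" using x \<theta>_thick[OF False] by (simp add: g_def Q_def)
        then show ?thesis using sum nb by linarith
      qed
    qed
  qed
qed

text \<open>Pigeonhole: rows are disjoint and each thick one uses more than \<open>4 * K\<close> of
  at most \<open>K * m\<close> sites, so at most a quarter of \<open>m\<close> rows are thick, while
  the interval contains at least half of \<open>m\<close> rows.\<close>

lemma card_thin_rows_ge:
  fixes B :: "site set" and s :: int and K m :: nat
  assumes B: "finite B" "card B \<le> K * m" and s: "s = 1 \<or> s = -1"
  shows "m \<le> 4 * card {k \<in> {int (m div 2)<..int m}. card (B \<inter> UNIV \<times> {s * k}) \<le> 4 * K}"
proof -
  let ?R = "\<lambda>k. B \<inter> UNIV \<times> {s * k}" and ?I = "{int (m div 2)<..int m}"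
  define I1 I2 where "I1 = {k \<in> ?I. card (?R k) \<le> 4 * K}" and "I2 = {k \<in> ?I. \<not> card (?R k) \<le> 4 * K}"
  have fin: "finite I1" "finite I2"
    unfolding I1_def I2_def by (rule finite_subset[of _ ?I]; auto)+
  have "card I2 * (4 * K + 1) = (\<Sum>k\<in>I2. 4 * K + 1)" by simp
  also have "\<dots> \<le> (\<Sum>k\<in>I2. card (?R k))" by (rule sum_mono) (auto simp: I2_def)
  also have "\<dots> = card (\<Union>k\<in>I2. ?R k)"
    using B s fin by (intro card_UN_disjoint[symmetric]) auto
  also have "\<dots> \<le> card B" using B by (intro card_mono) auto
  finally have "card I2 * (4 * K + 1) \<le> K * m" using B by linarith
  then have "K * (4 * card I2) + card I2 \<le> K * m" by (simp add: algebra_simps)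
  \<comment> \<open>For \<open>K = 0\<close> the extra summand \<open>card I2\<close> must vanish;
    otherwise it is dropped and \<open>K\<close> cancels.\<close>
  then have "4 * card I2 \<le> m"
    by (cases "K = 0") (auto dest!: add_leD1)
  moreover have "card I1 + card I2 = card ?I"
  proof -
    have "?I = I1 \<union> I2" "I1 \<inter> I2 = {}" by (auto simp: I1_def I2_def)
    then show ?thesis using card_Un_disjoint[OF fin] by (simp only:)
  qed
  moreover have "card ?I = m - m div 2" by simp
  ultimately show ?thesis unfolding I1_def by linarith
qed

text \<open>The fourth root turns one factor \<open>1 - (1 / 4) ^ (4 * K)\<close> for each of at
  least \<open>m / 4\<close> thin rows into the bound \<open>decay K ^ m\<close>, without
  rounding.\<close>

definition decay :: "nat \<Rightarrow> real" where
  "decay K = root 4 (1 - (1 / 4) ^ (4 * K))"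

lemma decay_bounds: "0 \<le> decay K" "decay K < 1"
  by (auto simp: decay_def power_le_one)

section \<open>From step counts to hitting probabilities\<close>

context prob_space
begin

lemma simple_random_walk_increment_measurable:
  assumes "simple_random_walk M x X"
  shows "(\<lambda>\<omega>. X (Suc t) \<omega> - X t \<omega>) \<in> M \<rightarrow>\<^sub>M count_space UNIV"
  using assms by (auto simp: simple_random_walk_def indep_vars_def)

lemma prob_increment_list:
  assumes X: "simple_random_walk M x X" and es: "set es \<subseteq> nn_steps" "length es = T"
  shows "prob {\<omega> \<in> space M. map (\<lambda>t. X (Suc t) \<omega> - X t \<omega>) [0..<T] = es} = (1 / 4) ^ T"
proof (cases "T = 0")
  \<comment> \<open>The empty list is handled apart because the product rule below is applied to a
    nonempty index set.\<close>
  case True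
  then show ?thesis using es by (simp add: prob_space)
next
  case False
  let ?Y = "\<lambda>t \<omega>. X (Suc t) \<omega> - X t \<omega>"
  have "{\<omega> \<in> space M. map (\<lambda>t. ?Y t \<omega>) [0..<T] = es} = (\<Inter>t\<in>{..<T}. ?Y t -` {es ! t} \<inter> space M)"
    using es False by (auto simp: list_eq_iff_nth_eq)
  also have "prob \<dots> = (\<Prod>t\<in>{..<T}. prob (?Y t -` {es ! t} \<inter> space M))"
    using X False by (intro indep_varsD[where M' = "\<lambda>_. count_space UNIV" and I = UNIV])
      (auto simp: simple_random_walk_def)
  also have "\<dots> = (\<Prod>t\<in>{..<T}. 1 / 4)"
  proof (rule prod.cong[OF refl])
    fix t assume "t \<in> {..<T}"
    then have "es ! t \<in> nn_steps" using es nth_mem by fastforce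
    have "prob (?Y t -` {es ! t} \<inter> space M) = measure (distr M (count_space UNIV) (?Y t)) {es ! t}"
      using simple_random_walk_increment_measurable[OF X] by (simp add: measure_distr)
    also have "distr M (count_space UNIV) (?Y t) = measure_pmf (pmf_of_set nn_steps)"
      using X by (simp add: simple_random_walk_def)
    also have "measure \<dots> {es ! t} = 1 / 4"
      using \<open>es ! t \<in> nn_steps\<close> by (subst measure_pmf_single, subst pmf_of_set) auto
    finally show "prob (?Y t -` {es ! t} \<inter> space M) = 1 / 4" .
  qed
  finally show ?thesis by simp
qed

text \<open>Each list of \<open>T\<close> steps has probability \<open>(1 / 4) ^ T\<close>, which
  cancels the factor in \<open>card_hits_le\<close>. The resulting bound is uniform in the horizon
  \<open>T\<close> and so survives the limit of the increasing finite-horizon events.\<close>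

lemma prob_visits_le_supersolution:
  fixes g :: "site \<Rightarrow> real"
  assumes X: "simple_random_walk M x X"
    and nonneg: "\<And>x. 0 \<le> g x"
    and target: "\<And>x. x \<in> H \<Longrightarrow> 1 \<le> g x"
    and super: "\<And>x. x \<in> A - H \<Longrightarrow> (\<Sum>e\<in>nn_steps. g (x + e)) \<le> 4 * g x"
  shows "prob {\<omega> \<in> space M. visits A H (\<lambda>t. X t \<omega>)} \<le> g x"
proof -
  let ?Y = "\<lambda>t \<omega>. X (Suc t) \<omega> - X t \<omega>"
  let ?L = "\<lambda>T \<omega>. map (\<lambda>t. ?Y t \<omega>) [0..<T]"
  define E where "E T = {\<omega> \<in> space M. hits A H x (?L T \<omega>)}" for T
  note [measurable] = simple_random_walk_increment_measurable[OF X]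
  \<comment> \<open>Lists of increments form a countable type, so the product of the two discrete
    sigma-algebras is discrete and appending a step is measurable.\<close>
  have L: "?L T \<in> M \<rightarrow>\<^sub>M count_space UNIV" for T
  proof (induction T)
    case (Suc T)
    note [measurable] = Suc
    have "(\<lambda>\<omega>. (?L T \<omega>, ?Y T \<omega>)) \<in> M \<rightarrow>\<^sub>M count_space UNIV \<Otimes>\<^sub>M count_space UNIV" by measurable
    then have "(\<lambda>\<omega>. (?L T \<omega>, ?Y T \<omega>)) \<in> M \<rightarrow>\<^sub>M count_space UNIV"
      by (simp add: pair_measure_countable)
    from measurable_compose[OF this, of "\<lambda>(l, y). l @ [y]" "count_space UNIV"]
    show ?case by simp
  qed simp
  have EL: "{\<omega> \<in> space M. ?L T \<omega> \<in> S} \<in> events" for T S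
    using measurable_sets[OF L, of S T] by (simp add: vimage_def Int_def conj_commute)
  have x0: "X 0 \<omega> = x" if "\<omega> \<in> space M" for \<omega>
    using X that by (simp add: simple_random_walk_def)
  have E_eq: "E T = {\<omega> \<in> space M. \<exists>t\<le>T. X t \<omega> \<in> H \<and> (\<forall>s<t. X s \<omega> \<in> A)}" for T
    unfolding E_def using x0 hits_increments_iff[of A H "\<lambda>t. X t _" T] by fastforce
  have E_events: "E T \<in> events" for T
    unfolding E_def using EL[of T "{es. hits A H x es}"] by simp
  have "prob (E T) \<le> g x" for T
  proof -
    let ?G = "{es. set es \<subseteq> nn_steps \<and> length es = T \<and> hits A H x es}"
    have UN_eq: "{\<omega> \<in> space M. ?L T \<omega> \<in> S} = (\<Union>es\<in>S. {\<omega> \<in> space M. ?L T \<omega> = es})" for S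
      by auto
    have fin: "finite ?G"
      by (rule finite_subset[OF _ finite_lists_length_eq[of nn_steps T]]) auto
    \<comment> \<open>Increments lie in \<open>nn_steps\<close> only almost surely, so
      \<open>E T\<close> is compared with the event of admissible lists up to a null set.\<close>
    have step: "AE \<omega> in M. ?Y t \<omega> \<in> nn_steps" for t
    proof -
      have "distr M (count_space UNIV) (?Y t) = measure_pmf (pmf_of_set nn_steps)"
        using X unfolding simple_random_walk_def by blast
      moreover have "AE y in measure_pmf (pmf_of_set nn_steps). y \<in> nn_steps"
        using AE_measure_pmf[of "pmf_of_set nn_steps"]
        by (simp only: set_pmf_of_set finite.intros insert_not_empty not_False_eq_True)
      ultimately have "AE y in distr M (count_space UNIV) (?Y t). y \<in> nn_steps"
        by (simp only:)
      then show ?thesis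
        using simple_random_walk_increment_measurable[OF X]
        by (rule AE_distrD[where P = "\<lambda>y. y \<in> nn_steps", rotated])
    qed
    have "AE \<omega> in M. \<forall>t. ?Y t \<omega> \<in> nn_steps"
      using step unfolding AE_all_countable by blast
    then have "AE \<omega> in M. \<omega> \<in> E T \<longrightarrow> \<omega> \<in> {\<omega> \<in> space M. ?L T \<omega> \<in> ?G}"
      by eventually_elim (simp add: E_def image_subset_iff del: insert_iff)
    then have "prob (E T) \<le> prob {\<omega> \<in> space M. ?L T \<omega> \<in> ?G}"
      by (rule finite_measure_mono_AE[OF _ EL])
    also have "{\<omega> \<in> space M. ?L T \<omega> \<in> ?G} = (\<Union>es\<in>?G. {\<omega> \<in> space M. ?L T \<omega> = es})"
      by (rule UN_eq)
    also have "prob \<dots> \<le> (\<Sum>es\<in>?G. prob {\<omega> \<in> space M. ?L T \<omega> = es})"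
      using EL[of T "{_}"] fin by (intro finite_measure_subadditive_finite) auto
    also have "\<dots> = (\<Sum>es\<in>?G. (1 / 4) ^ T)"
      using prob_increment_list[OF X] by (intro sum.cong) auto
    also have "\<dots> = real (card ?G) * (1 / 4) ^ T" by simp
    also have "\<dots> \<le> (4 ^ T * g x) * (1 / 4) ^ T"
      by (intro mult_right_mono card_hits_le assms) auto
    also have "\<dots> = g x" by (simp add: power_divide)
    finally show ?thesis .
  qed
  moreover have "(\<lambda>T. prob (E T)) \<longlonglongrightarrow> prob (\<Union>T. E T)"
  proof (rule finite_Lim_measure_incseq)
    show "range E \<subseteq> events" using E_events by auto
    show "incseq E" by (auto simp: incseq_def E_eq intro: order_trans)
  qed
  ultimately have "prob (\<Union>T. E T) \<le> g x"
    by (intro LIMSEQ_le_const2) auto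
  moreover have "(\<Union>T. E T) = {\<omega> \<in> space M. visits A H (\<lambda>t. X t \<omega>)}"
    by (auto simp: E_eq visits_def)
  ultimately show ?thesis by simp
qed

text \<open>At least a quarter of \<bar>i\<bar> rows between the start and the strip are thin, and
  the supersolution loses a factor at each.\<close>

lemma prob_visits_strip_le:
  assumes X: "simple_random_walk M (0, i) X"
    and path: "(\<lambda>\<omega> t. X t \<omega>) \<in> M \<rightarrow>\<^sub>M path_space"
    and B: "finite B" "card B \<le> K * nat \<bar>i\<bar>"
  shows "prob {\<omega> \<in> space M. visits B (strip (nat \<bar>i\<bar> div 2)) (\<lambda>t. X t \<omega>)} \<le> decay K ^ nat \<bar>i\<bar>"
proof -
  define m where "m = nat \<bar>i\<bar>"
  define s :: int where "s = (if i \<ge> 0 then 1 else -1)"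
  define q where "q = 1 - (1 / 4 :: real) ^ (4 * K)"
  define \<theta> where "\<theta> = card {k \<in> {int (m div 2)<..int m}. card (B \<inter> UNIV \<times> {s * k}) \<le> 4 * K}"
  have s: "s = 1 \<or> s = -1" and sm: "s * i = int m" by (auto simp: s_def m_def)
  obtain g :: "site \<Rightarrow> real" where g: "\<forall>x. 0 \<le> g x"
    "\<forall>x. s * snd x \<le> int (m div 2) \<longrightarrow> 1 \<le> g x"
    "\<forall>x\<in>B. s * snd x > int (m div 2) \<longrightarrow> (\<Sum>e\<in>nn_steps. g (x + e)) \<le> 4 * g x"
    "\<forall>x. g x \<le> q ^ card {k \<in> {int (m div 2)<..s * snd x}. card (B \<inter> UNIV \<times> {s * k}) \<le> 4 * K}"
    using ex_supersolution[OF B(1) s, of "int (m div 2)" "4 * K"] unfolding q_def by blast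
  \<comment> \<open>The strip is enlarged to a half-plane on which the supersolution is at least
    1.\<close>
  let ?H = "{x :: site. s * snd x \<le> int (m div 2)}"
  have "strip (m div 2) \<subseteq> ?H" using s by (auto simp: strip_def)
  then have sub: "visits B (strip (m div 2)) Y \<Longrightarrow> visits B ?H Y" for Y
    unfolding visits_def by blast
  have "{\<omega> \<in> space M. visits B ?H (\<lambda>t. X t \<omega>)} \<in> events"
    using measurable_compose[OF path pred_visits] by (simp add: pred_def)
  then have "prob {\<omega> \<in> space M. visits B (strip (m div 2)) (\<lambda>t. X t \<omega>)} \<le>
      prob {\<omega> \<in> space M. visits B ?H (\<lambda>t. X t \<omega>)}"
    using sub by (intro finite_measure_mono) auto
  also have "\<dots> \<le> g (0, i)"
  proof (rule prob_visits_le_supersolution[OF X])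
    show "0 \<le> g x" for x using g(1) by blast
    show "1 \<le> g x" if "x \<in> ?H" for x using that g(2) by blast
    show "(\<Sum>e\<in>nn_steps. g (x + e)) \<le> 4 * g x" if "x \<in> B - ?H" for x
      using that g(3) by (metis DiffD1 DiffD2 mem_Collect_eq not_le)
  qed
  also have "\<dots> \<le> q ^ \<theta>"
    using g(4)[rule_format, of "(0, i)"] by (simp only: \<theta>_def snd_conv sm)
  also have "q ^ \<theta> = decay K ^ (4 * \<theta>)"
    by (simp add: decay_def q_def power_mult power_le_one)
  also have "\<dots> \<le> decay K ^ m"
    using card_thin_rows_ge[OF B(1) _ s, of K m] B(2) decay_bounds[of K]
    by (intro power_decreasing) (auto simp: \<theta>_def m_def)
  finally show ?thesis by (simp add: m_def)
qed

end

section \<open>Walks in a random aggregate\<close>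

abbreviation walks_algebra where
  "walks_algebra P S \<equiv> vimage_algebra (space P) (\<lambda>\<omega>. \<lambda>(i, j)\<in>walk_index. \<lambda>t. S i j t \<omega>)
     (PiM walk_index (\<lambda>_. path_space))"

abbreviation counts_algebra where
  "counts_algebra P N \<equiv> vimage_algebra (space P) (\<lambda>\<omega> i. N i \<omega>) (PiM UNIV (\<lambda>_. count_space UNIV))"

abbreviation total_count :: "(int \<Rightarrow> nat) \<Rightarrow> nat \<Rightarrow> nat" where
  "total_count c m \<equiv> \<Sum>k\<in>{-int m..int m}. c k"

context prob_space
begin

text \<open>Total probability over a countable disjoint family, with products in place of
  conditional probabilities: the sum of \<open>prob (F b) * prob (G b)\<close> is at most \<rho>
  times the total mass of the \<open>F b\<close>. The events \<open>G b\<close> may overlap.\<close>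

lemma prob_UN_indep_le:
  assumes T: "countable T"
    and F: "\<And>b. b \<in> T \<Longrightarrow> F b \<in> events" "disjoint_family_on F T"
    and G: "\<And>b. b \<in> T \<Longrightarrow> G b \<in> events" "\<And>b. b \<in> T \<Longrightarrow> prob (G b) \<le> \<rho>"
    and indep: "\<And>b. b \<in> T \<Longrightarrow> prob (F b \<inter> G b) = prob (F b) * prob (G b)"
    and \<rho>: "0 \<le> \<rho>"
  shows "prob (\<Union>b\<in>T. F b \<inter> G b) \<le> \<rho>"
proof -
  have "emeasure M (\<Union>b\<in>T. F b \<inter> G b) = (\<integral>\<^sup>+b. emeasure M (F b \<inter> G b) \<partial>count_space T)"
    using T F G by (intro emeasure_UN_countable) (auto simp: disjoint_family_on_def)
  also have "\<dots> \<le> (\<integral>\<^sup>+b. ennreal \<rho> * emeasure M (F b) \<partial>count_space T)"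
  proof (rule nn_integral_mono)
    fix b assume "b \<in> space (count_space T)"
    then have b: "b \<in> T" by simp
    have "prob (F b) * prob (G b) \<le> \<rho> * prob (F b)"
      using G(2)[OF b] by (subst mult.commute) (intro mult_right_mono, auto)
    then show "emeasure M (F b \<inter> G b) \<le> ennreal \<rho> * emeasure M (F b)"
      using indep[OF b] \<rho> by (simp add: emeasure_eq_measure ennreal_mult[symmetric] ennreal_leI)
  qed
  also have "\<dots> = ennreal \<rho> * (\<integral>\<^sup>+b. emeasure M (F b) \<partial>count_space T)"
    by (rule nn_integral_cmult) simp
  also have "(\<integral>\<^sup>+b. emeasure M (F b) \<partial>count_space T) = emeasure M (\<Union>b\<in>T. F b)"
    using T F by (intro emeasure_UN_countable[symmetric]) auto
  also have "ennreal \<rho> * emeasure M (\<Union>b\<in>T. F b) \<le> ennreal \<rho> * 1"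
    by (intro mult_left_mono measure_le_1) simp_all
  finally show ?thesis using \<rho> by (simp add: emeasure_eq_measure)
qed

lemma measurable_walk:
  assumes "walk_family M S" "1 \<le> j"
  shows "(\<lambda>\<omega> t. S i j t \<omega>) \<in> M \<rightarrow>\<^sub>M path_space"
  using assms by (auto simp: walk_family_def indep_vars_def)

text \<open>The aggregate takes countably many values and is independent of the walk of particle
  \<open>(i, j)\<close>, so it can be conditioned on value by value.\<close>

lemma prob_particle_visits_le:
  assumes S: "walk_family M S"
    and j: "1 \<le> j" "j \<le> c i" and total: "total_count c (nat \<bar>i\<bar>) \<le> K * nat \<bar>i\<bar>"
  shows "prob {\<omega> \<in> space M. visits (aggregate_before c (\<lambda>i j t. S i j t \<omega>) i j)
      (strip (nat \<bar>i\<bar> div 2)) (\<lambda>t. S i j t \<omega>)} \<le> decay K ^ nat \<bar>i\<bar>"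
proof -
  let ?H = "strip (nat \<bar>i\<bar> div 2)"
  let ?A = "\<lambda>\<omega>. aggregate_before c (\<lambda>i j t. S i j t \<omega>) i j"
  define J where "J = walk_index - {(i, j)}"
  define W where "W = (\<lambda>(i, j) \<omega> t. S i j t \<omega>)"
  define T where "T = {B :: site set. finite B \<and> card B \<le> K * nat \<bar>i\<bar>}"
  define F where "F B = {\<omega> \<in> space M. ?A \<omega> = B}" for B
  define G where "G B = {\<omega> \<in> space M. visits B ?H (\<lambda>t. S i j t \<omega>)}" for B
  have ij: "(i, j) \<in> walk_index" using j by simp
  note walk = measurable_walk[OF S]
  have "?A \<omega> \<in> T" for \<omega>
    using card_aggregate_before_le[of j c i, OF j(2)] total by (auto simp: T_def finite_aggregate_before intro: order_trans)
  then have eq: "{\<omega> \<in> space M. visits (?A \<omega>) ?H (\<lambda>t. S i j t \<omega>)} = (\<Union>B\<in>T. F B \<inter> G B)"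
    by (auto simp: F_def G_def)
  have A: "?A \<in> M \<rightarrow>\<^sub>M finite_sites"
    using walk by (intro measurable_aggregate_before) auto
  show ?thesis
    unfolding eq
  proof (rule prob_UN_indep_le)
    show "countable T"
      by (rule countable_subset[OF _ countable_finite_sites]) (auto simp: T_def)
    show "disjoint_family_on F T"
      by (auto simp: disjoint_family_on_def F_def)
    show "0 \<le> decay K ^ nat \<bar>i\<bar>" using decay_bounds by simp
    fix B assume B: "B \<in> T"
    show "F B \<in> events"
      using measurable_sets[OF A, of "{B}"] B by (simp add: F_def T_def vimage_def Int_def conj_commute)
    show "G B \<in> events"
      using measurable_compose[OF walk pred_visits] j by (simp add: G_def pred_def)
    have "simple_random_walk M (0, i) (S i j)"
      using S j by (auto simp: walk_family_def)
    then show "prob (G B) \<le> decay K ^ nat \<bar>i\<bar>"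
      unfolding G_def using B j walk by (intro prob_visits_strip_le) (auto simp: T_def)
    \<comment> \<open>\<open>XF\<close> and \<open>XG\<close> are events in the path spaces of two
      disjoint blocks of walks. Their preimages are \<open>F B\<close> and \<open>G B\<close>, so
      independence of the blocks transfers.\<close>
    let ?f = "\<lambda>x. aggregate_before c (\<lambda>k l. x (k, l)) i j"
    define XF where "XF = ?f -` {B} \<inter> space (PiM J (\<lambda>_. path_space))"
    define XG where "XG = {x \<in> space (PiM {(i, j)} (\<lambda>_. path_space)). visits B ?H (x (i, j))}"
    have "?f \<in> PiM J (\<lambda>_. path_space) \<rightarrow>\<^sub>M finite_sites"
      by (rule measurable_aggregate_before) (simp add: J_def)
    then have XF: "XF \<in> sets (PiM J (\<lambda>_. path_space))"
      unfolding XF_def by (rule measurable_sets) (use B in \<open>simp add: T_def\<close>)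
    have "(\<lambda>x. x (i, j)) \<in> PiM {(i, j)} (\<lambda>_. path_space) \<rightarrow>\<^sub>M path_space"
      by simp
    from measurable_compose[OF this pred_visits] have XG: "XG \<in> sets (PiM {(i, j)} (\<lambda>_. path_space))"
      by (simp add: XG_def pred_def)
    have "indep_vars (\<lambda>_. path_space) W walk_index"
      using S by (simp add: walk_family_def W_def)
    then have "indep_var (PiM J (\<lambda>_. path_space)) (\<lambda>\<omega>. \<lambda>p\<in>J. W p \<omega>)
        (PiM {(i, j)} (\<lambda>_. path_space)) (\<lambda>\<omega>. \<lambda>p\<in>{(i, j)}. W p \<omega>)"
      by (rule indep_var_restrict) (use ij in \<open>auto simp: J_def\<close>)
    note indep = indep_varD[OF this XF XG]
    \<comment> \<open>Restriction makes the walk \<open>(i, j)\<close> undefined, but the aggregate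
      before this particle does not read it.\<close>
    have "?f (\<lambda>p\<in>J. W p \<omega>) = ?A \<omega>" for \<omega>
      by (rule aggregate_before_cong) (auto simp: J_def W_def)
    then have F: "(\<lambda>\<omega>. \<lambda>p\<in>J. W p \<omega>) -` XF \<inter> space M = F B"
      by (auto simp: XF_def F_def space_PiM)
    have G: "(\<lambda>\<omega>. \<lambda>p\<in>{(i, j)}. W p \<omega>) -` XG \<inter> space M = G B"
      by (auto simp: XG_def G_def W_def space_PiM)
    have FG: "(\<lambda>\<omega>. (\<lambda>p\<in>J. W p \<omega>, \<lambda>p\<in>{(i, j)}. W p \<omega>)) -` (XF \<times> XG) \<inter> space M = F B \<inter> G B"
      using F G by blast
    show "prob (F B \<inter> G B) = prob (F B) * prob (G B)"
      using indep unfolding F G FG .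
  qed
qed

text \<open>With the linear bound on the counts inside the event, its probability is small whatever
  the law of the counts. That the bound eventually holds is shown separately.\<close>

definition bad_particle ::
    "(int \<Rightarrow> nat \<Rightarrow> nat \<Rightarrow> 'a \<Rightarrow> site) \<Rightarrow> (int \<Rightarrow> 'a \<Rightarrow> nat) \<Rightarrow> nat \<Rightarrow> int \<Rightarrow> nat \<Rightarrow> 'a set" where
  "bad_particle S N K i j = {\<omega> \<in> space M. j \<le> N i \<omega> \<and>
     total_count (\<lambda>k. N k \<omega>) (nat \<bar>i\<bar>) \<le> K * nat \<bar>i\<bar> \<and>
     visits (aggregate_before (\<lambda>k. N k \<omega>) (\<lambda>i j t. S i j t \<omega>) i j)
       (strip (nat \<bar>i\<bar> div 2)) (\<lambda>t. S i j t \<omega>)}"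

text \<open>Counts are independent of the walks, so they can be frozen on the levels up to
  \<bar>i\<bar>, and the estimate for deterministic counts applies to each value of the count
  vector.\<close>

lemma prob_bad_particle_le:
  assumes S: "walk_family M S" and j: "1 \<le> j"
    and indep: "indep_set (sets (counts_algebra M N)) (sets (walks_algebra M S))"
  shows "bad_particle S N K i j \<in> events" "prob (bad_particle S N K i j) \<le> decay K ^ nat \<bar>i\<bar>"
proof -
  let ?H = "strip (nat \<bar>i\<bar> div 2)" and ?I = "{-int (nat \<bar>i\<bar>)..int (nat \<bar>i\<bar>)}"
  \<comment> \<open>Extensional functions on finitely many levels are countably many, and two
    different ones differ at a level of \<open>?I\<close>, which makes the events \<open>F v\<close>
    disjoint.\<close>
  define T where "T = PiE ?I (\<lambda>_. UNIV :: nat set)"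
  define F where "F v = {\<omega> \<in> space M. \<forall>k\<in>?I. N k \<omega> = v k}" for v
  define G where "G v = {\<omega> \<in> space M. j \<le> v i \<and> total_count v (nat \<bar>i\<bar>) \<le> K * nat \<bar>i\<bar> \<and>
    visits (aggregate_before v (\<lambda>i j t. S i j t \<omega>) i j) ?H (\<lambda>t. S i j t \<omega>)}" for v
  have T: "countable T" unfolding T_def by (rule countable_PiE) auto
  have F: "F v \<in> sets (counts_algebra M N)" for v
  proof -
    have "{x. \<forall>k\<in>?I. x k = v k} \<in> sets (PiM UNIV (\<lambda>_ :: int. count_space (UNIV :: nat set)))"
    proof -
      have "Measurable.pred (PiM UNIV (\<lambda>_ :: int. count_space (UNIV :: nat set))) (\<lambda>x. \<forall>k\<in>?I. x k = v k)"
        by measurable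
      then show ?thesis by (simp add: pred_def space_PiM)
    qed
    from in_vimage_algebra[OF this, of "\<lambda>\<omega> i. N i \<omega>" "space M"]
    show ?thesis by (simp add: F_def vimage_def Int_def conj_commute)
  qed
  have G: "G v \<in> sets (walks_algebra M S)" for v
  proof -
    let ?Q = "PiM walk_index (\<lambda>_. path_space)"
    have "Measurable.pred ?Q (\<lambda>x. visits (aggregate_before v (\<lambda>k l. x (k, l)) i j) ?H (x (i, j)))"
    proof (rule measurable_compose_countable'[OF _ _ countable_finite_sites,
          where f = "\<lambda>B x. visits B ?H (x (i, j))"])
      show "(\<lambda>x. aggregate_before v (\<lambda>k l. x (k, l)) i j) \<in> ?Q \<rightarrow>\<^sub>M finite_sites"
        by (rule measurable_aggregate_before) simp
      have "(\<lambda>x. x (i, j)) \<in> ?Q \<rightarrow>\<^sub>M path_space" using j by simp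
      then show "(\<lambda>x. visits B ?H (x (i, j))) \<in> ?Q \<rightarrow>\<^sub>M count_space UNIV" for B
        by (rule measurable_compose) (rule pred_visits)
    qed
    then have "{x \<in> space ?Q. visits (aggregate_before v (\<lambda>k l. x (k, l)) i j) ?H (x (i, j))} \<in> sets ?Q"
      by (simp add: pred_def)
    note V = in_vimage_algebra[OF this, of "\<lambda>\<omega>. \<lambda>(i, j)\<in>walk_index. \<lambda>t. S i j t \<omega>" "space M"]
    have cong: "aggregate_before v (\<lambda>k l. (\<lambda>(i, j)\<in>walk_index. \<lambda>t. S i j t \<omega>) (k, l)) i j =
        aggregate_before v (\<lambda>i j t. S i j t \<omega>) i j" for \<omega>
      by (rule aggregate_before_cong) auto
    show ?thesis
    proof (cases "j \<le> v i \<and> total_count v (nat \<bar>i\<bar>) \<le> K * nat \<bar>i\<bar>")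
      case True
      have "G v = (\<lambda>\<omega>. \<lambda>(i, j)\<in>walk_index. \<lambda>t. S i j t \<omega>) -`
          {x \<in> space ?Q. visits (aggregate_before v (\<lambda>k l. x (k, l)) i j) ?H (x (i, j))} \<inter> space M"
        using True j cong by (auto simp: G_def space_PiM)
      then show ?thesis using V by simp
    next
      case False
      then have "G v = {}" by (auto simp: G_def)
      then show ?thesis by simp
    qed
  qed
  have ind: "sets (counts_algebra M N) \<subseteq> events" "sets (walks_algebra M S) \<subseteq> events"
    "\<And>a b. a \<in> sets (counts_algebra M N) \<Longrightarrow> b \<in> sets (walks_algebra M S) \<Longrightarrow>
      prob (a \<inter> b) = prob a * prob b"
    using indep unfolding indep_sets2_eq by blast+
  have FG: "F v \<in> events" "G v \<in> events" "prob (F v \<inter> G v) = prob (F v) * prob (G v)" for v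
    using F[of v] G[of v] ind by blast+
  have good: "\<omega> \<in> bad_particle S N K i j \<longleftrightarrow> \<omega> \<in> G v" if "\<omega> \<in> F v" for \<omega> v
  proof -
    have v: "N k \<omega> = v k" if "k \<in> ?I" for k using that \<open>\<omega> \<in> F v\<close> by (simp add: F_def)
    have "total_count (\<lambda>k. N k \<omega>) (nat \<bar>i\<bar>) = total_count v (nat \<bar>i\<bar>)"
      by (rule sum.cong[OF refl v])
    moreover have "aggregate_before (\<lambda>k. N k \<omega>) (\<lambda>i j t. S i j t \<omega>) i j =
        aggregate_before v (\<lambda>i j t. S i j t \<omega>) i j"
      by (rule aggregate_before_cong) (auto intro!: v)
    moreover have "N i \<omega> = v i" by (rule v) auto
    ultimately show ?thesis using \<open>\<omega> \<in> F v\<close> by (simp add: G_def F_def bad_particle_def)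
  qed
  have eq: "bad_particle S N K i j = (\<Union>v\<in>T. F v \<inter> G v)"
  proof -
    have "\<omega> \<in> F (\<lambda>k\<in>?I. N k \<omega>)" "(\<lambda>k\<in>?I. N k \<omega>) \<in> T" if "\<omega> \<in> space M" for \<omega>
      using that by (auto simp: F_def T_def)
    moreover have "bad_particle S N K i j \<subseteq> space M" by (auto simp: bad_particle_def)
    ultimately show ?thesis using good by blast
  qed
  show "bad_particle S N K i j \<in> events"
    unfolding eq using T FG by (intro sets.countable_UN') auto
  show "prob (bad_particle S N K i j) \<le> decay K ^ nat \<bar>i\<bar>"
    unfolding eq
  proof (rule prob_UN_indep_le[OF T])
    show "disjoint_family_on F T"
      unfolding disjoint_family_on_def
    proof (intro ballI impI)
      fix v v' assume "v \<in> T" "v' \<in> T" "v \<noteq> v'"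
      then obtain k where "k \<in> ?I" "v k \<noteq> v' k"
        unfolding T_def by (meson PiE_ext)
      then show "F v \<inter> F v' = {}" by (auto simp: F_def)
    qed
    show "0 \<le> decay K ^ nat \<bar>i\<bar>" using decay_bounds by simp
    fix v
    show "prob (G v) \<le> decay K ^ nat \<bar>i\<bar>"
    proof (cases "j \<le> v i \<and> total_count v (nat \<bar>i\<bar>) \<le> K * nat \<bar>i\<bar>")
      case True
      then show ?thesis
        using prob_particle_visits_le[OF S j, of v i K] by (simp add: G_def)
    next
      case False
      then have "G v = {}" by (auto simp: G_def)
      then show ?thesis using decay_bounds by simp
    qed
  qed (rule FG)+
qed

end

section \<open>Borel-Cantelli over the levels\<close>

lemma visits_mono: "visits A H X \<Longrightarrow> H \<subseteq> H' \<Longrightarrow> visits A H' X"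
  unfolding visits_def by blast

context prob_space
begin

text \<open>The number of particles on a level is random, but the linear bound inside a bad event
  forces \<open>j \<le> K * m\<close>. Hence \<open>E m\<close> is a finite union, and its
  probability is summable in \<open>m\<close>.\<close>

lemma AE_eventually_no_bad_particle:
  assumes S: "walk_family M S"
    and indep: "indep_set (sets (counts_algebra M N)) (sets (walks_algebra M S))"
  shows "AE \<omega> in M. \<forall>\<^sub>F m in sequentially.
    \<forall>i j. nat \<bar>i\<bar> = m \<longrightarrow> 1 \<le> j \<longrightarrow> \<omega> \<notin> bad_particle S N K i j"
proof -
  define E where "E m = (\<Union>(i, j)\<in>{int m, - int m} \<times> {1..K * m}. bad_particle S N K i j)" for m
  have bad: "bad_particle S N K i j \<in> events"
    "prob (bad_particle S N K i j) \<le> decay K ^ nat \<bar>i\<bar>" if "1 \<le> j" for i j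
    using prob_bad_particle_le[OF S that indep] by auto
  have E: "E m \<in> events" for m
    unfolding E_def using bad by (intro sets.finite_UN) auto
  have prob_E: "prob (E m) \<le> 2 * real K * (real (Suc m) * decay K ^ m)" for m
  proof -
    have "prob (E m) \<le> (\<Sum>p\<in>{int m, - int m} \<times> {1..K * m}. prob (case p of (i, j) \<Rightarrow> bad_particle S N K i j))"
      unfolding E_def using bad by (intro finite_measure_subadditive_finite) auto
    also have "\<dots> \<le> (\<Sum>p\<in>{int m, - int m} \<times> {1..K * m}. decay K ^ m)"
    proof (rule sum_mono)
      fix p assume "p \<in> {int m, - int m} \<times> {1..K * m}"
      then obtain i j where "p = (i, j)" "1 \<le> j" "nat \<bar>i\<bar> = m" by auto
      then show "prob (case p of (i, j) \<Rightarrow> bad_particle S N K i j) \<le> decay K ^ m"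
        using bad(2)[of j i] by simp
    qed
    also have "\<dots> = real (card {int m, - int m} * (K * m)) * decay K ^ m"
      by (simp add: card_cartesian_product)
    \<comment> \<open>\<open>Suc m\<close> matches the derivative of the geometric series used
      below. The two levels coincide for \<open>m = 0\<close>, so their number is only bounded by
      2.\<close>
    also have "\<dots> \<le> real (2 * (K * Suc m)) * decay K ^ m"
    proof (rule mult_right_mono)
      have "card {int m, - int m} \<le> 2" by (simp add: card_insert_if)
      then show "real (card {int m, - int m} * (K * m)) \<le> real (2 * (K * Suc m))"
        unfolding of_nat_le_iff by (intro mult_mono) auto
    qed (use decay_bounds in simp)
    finally show ?thesis by (simp add: algebra_simps)
  qed
  have "summable (\<lambda>m. real (Suc m) * decay K ^ m)"
    using geometric_deriv_sums[of "decay K"] decay_bounds[of K] by (auto simp: sums_iff)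
  then have "summable (\<lambda>m. 2 * real K * (real (Suc m) * decay K ^ m))"
    by (rule summable_mult)
  then have "summable (\<lambda>m. prob (E m))"
    by (rule summable_comparison_test_ev[rotated]) (use prob_E in auto)
  then have "AE \<omega> in M. \<forall>\<^sub>F m in sequentially. \<omega> \<in> space M - E m"
    using E by (intro borel_cantelli_AE1) (auto simp: less_top[symmetric])
  then show ?thesis
  proof eventually_elim
    fix \<omega> assume "\<forall>\<^sub>F m in sequentially. \<omega> \<in> space M - E m"
    then show "\<forall>\<^sub>F m in sequentially.
        \<forall>i j. nat \<bar>i\<bar> = m \<longrightarrow> 1 \<le> j \<longrightarrow> \<omega> \<notin> bad_particle S N K i j"
    proof eventually_elim
      fix m assume m: "\<omega> \<in> space M - E m"
      show "\<forall>i j. nat \<bar>i\<bar> = m \<longrightarrow> 1 \<le> j \<longrightarrow> \<omega> \<notin> bad_particle S N K i j"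
      proof (intro allI impI notI)
        fix i j assume ij: "nat \<bar>i\<bar> = m" "1 \<le> j" and \<omega>: "\<omega> \<in> bad_particle S N K i j"
        have "N i \<omega> \<le> total_count (\<lambda>k. N k \<omega>) m"
          using ij by (intro member_le_sum) auto
        then have "j \<le> K * m" using \<omega> ij by (auto simp: bad_particle_def)
        moreover have "i \<in> {int m, - int m}" using ij by auto
        ultimately have "(i, j) \<in> {int m, - int m} \<times> {1..K * m}" using ij(2) by simp
        then have "\<omega> \<in> E m" unfolding E_def by (rule UN_I) (simp add: \<omega>)
        then show False using m by blast
      qed
    qed
  qed
qed

text \<open>Common core of both cases. Once the linear bound holds and no particle is bad, every
  particle from a high level avoids the strip of half its height.\<close>

lemma AE_trajectories_avoid_strip:
  assumes S: "walk_family M S"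
    and indep: "indep_set (sets (counts_algebra M N)) (sets (walks_algebra M S))"
    and total: "AE \<omega> in M. \<forall>\<^sub>F m in sequentially. total_count (\<lambda>k. N k \<omega>) m \<le> K * m"
    and \<alpha>: "1 < \<alpha>"
  shows "AE \<omega> in M. \<exists>M\<^sub>0\<ge>1. \<forall>L\<ge>M\<^sub>0.
    \<forall>(i, j) \<in> contributing_particles (\<lambda>i. N i \<omega>).
      real_of_int \<bar>i\<bar> > real L powr \<alpha> \<longrightarrow>
      particle_trajectory (\<lambda>i. N i \<omega>) (\<lambda>i j t. S i j t \<omega>) i j \<inter> strip L = {}"
  using AE_eventually_no_bad_particle[OF S indep, of K] total AE_space
proof eventually_elim
  fix \<omega>
  assume bad: "\<forall>\<^sub>F m in sequentially. \<forall>i j. nat \<bar>i\<bar> = m \<longrightarrow> 1 \<le> j \<longrightarrow> \<omega> \<notin> bad_particle S N K i j"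
    and total: "\<forall>\<^sub>F m in sequentially. total_count (\<lambda>k. N k \<omega>) m \<le> K * m"
    and \<omega>: "\<omega> \<in> space M"
  from eventually_conj[OF bad total] obtain m0 where
    m0: "\<And>i j. m0 \<le> nat \<bar>i\<bar> \<Longrightarrow> 1 \<le> j \<Longrightarrow> \<omega> \<notin> bad_particle S N K i j"
      "\<And>m. m0 \<le> m \<Longrightarrow> total_count (\<lambda>k. N k \<omega>) m \<le> K * m"
    unfolding eventually_sequentially by blast
  \<comment> \<open>Here \<alpha> > 1 enters: \<open>\<bar>i\<bar> > L powr \<alpha>\<close> then
    puts \<bar>i\<bar> beyond \<open>m0\<close> and makes \<open>L\<close> at most half of
    \<bar>i\<bar>.\<close>
  have "\<forall>\<^sub>F L in sequentially. real m0 \<le> real L powr \<alpha>" "\<forall>\<^sub>F L in sequentially. 2 * real L \<le> real L powr \<alpha>"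
    using \<alpha> by real_asymp+
  from eventually_conj[OF this] obtain L0 where
    L0: "\<And>L. L0 \<le> L \<Longrightarrow> real m0 \<le> real L powr \<alpha>" "\<And>L. L0 \<le> L \<Longrightarrow> 2 * real L \<le> real L powr \<alpha>"
    unfolding eventually_sequentially by blast
  have "particle_trajectory (\<lambda>i. N i \<omega>) (\<lambda>i j t. S i j t \<omega>) i j \<inter> strip L = {}"
    if L: "max 1 L0 \<le> L" and ij: "(i, j) \<in> contributing_particles (\<lambda>i. N i \<omega>)"
      and i: "real_of_int \<bar>i\<bar> > real L powr \<alpha>" for L i j
  proof -
    have j: "1 \<le> j" "j \<le> N i \<omega>"
      using ij by (auto simp: contributing_particles_def particles_def)
    have "real m0 \<le> real (nat \<bar>i\<bar>)" "2 * real L \<le> real (nat \<bar>i\<bar>)"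
      using L0[of L] L i by auto
    then have m: "m0 \<le> nat \<bar>i\<bar>" "L \<le> nat \<bar>i\<bar> div 2" by linarith+
    have "strip L \<subseteq> strip (nat \<bar>i\<bar> div 2)"
      using m(2) by (auto simp: strip_def)
    moreover have "\<not> visits (aggregate_before (\<lambda>i. N i \<omega>) (\<lambda>i j t. S i j t \<omega>) i j)
        (strip (nat \<bar>i\<bar> div 2)) (\<lambda>t. S i j t \<omega>)"
      using m0(1)[OF m(1) j(1)] m0(2)[OF m(1)] j(2) \<omega> unfolding bad_particle_def by blast
    ultimately show ?thesis
      unfolding particle_trajectory_def trajectory_Int_eq_empty_iff by (blast dest: visits_mono)
  qed
  then show "\<exists>M\<^sub>0\<ge>1. \<forall>L\<ge>M\<^sub>0. \<forall>(i, j) \<in> contributing_particles (\<lambda>i. N i \<omega>).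
      real_of_int \<bar>i\<bar> > real L powr \<alpha> \<longrightarrow>
      particle_trajectory (\<lambda>i. N i \<omega>) (\<lambda>i j t. S i j t \<omega>) i j \<inter> strip L = {}"
    by (intro exI[of _ "max 1 L0"]) auto
qed

text \<open>Constants generate the trivial sigma-algebra, which is independent of every other. Fixed
  counts thus become a case of random ones.\<close>

lemma indep_set_constant_counts:
  assumes S: "walk_family M S"
  shows "indep_set (sets (counts_algebra M (\<lambda>i \<omega>. c i))) (sets (walks_algebra M S))"
proof -
  have "sets (counts_algebra M (\<lambda>i \<omega>. c i)) \<subseteq> {{}, space M}"
  proof -
    have "(\<lambda>\<omega> i. c i) -` A \<inter> space M \<in> {{}, space M}" for A by auto
    then have "{(\<lambda>\<omega> i. c i) -` A \<inter> space M | A. A \<in> sets (PiM UNIV (\<lambda>_. count_space UNIV))}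
        \<subseteq> {{}, space M}" by blast
    then show ?thesis
      unfolding sets_vimage_algebra
      by (rule sigma_algebra.sigma_sets_subset[OF sigma_algebra_trivial])
  qed
  moreover have "sets (walks_algebra M S) \<subseteq> events"
    using measurable_walk[OF S]
    by (intro sets_image_in_sets measurable_restrict) auto
  ultimately show ?thesis
    unfolding indep_sets2_eq
    by (auto simp: prob_space Int_absorb1 sets.sets_into_space subset_iff)
qed

end

section \<open>Poisson counts\<close>

text \<open>The Poisson generating function \<open>exp (r * (z - 1))\<close> at
  \<open>z = 2\<close>.\<close>

lemma nn_integral_two_power_poisson:
  assumes "0 < r"
  shows "(\<integral>\<^sup>+k. ennreal (2 ^ k) \<partial>measure_pmf (poisson_pmf r)) = ennreal (exp r)"
proof -
  have "(\<integral>\<^sup>+k. ennreal (2 ^ k) \<partial>measure_pmf (poisson_pmf r)) =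
      (\<Sum>k. ennreal (pmf (poisson_pmf r) k) * ennreal (2 ^ k))"
    by (simp only: nn_integral_measure_pmf nn_integral_count_space_nat)
  also have "\<dots> = (\<Sum>k. ennreal (pmf (poisson_pmf r) k * 2 ^ k))"
    by (simp add: ennreal_mult)
  also have "\<dots> = ennreal (exp r)"
  proof (rule suminf_ennreal_eq)
    have "(\<lambda>k. exp (- r) * ((2 * r) ^ k /\<^sub>R fact k)) sums (exp (- r) * exp (2 * r))"
      by (intro sums_mult exp_converges)
    also have "exp (- r) * exp (2 * r) = exp r"
      by (simp flip: exp_add)
    also have "(\<lambda>k. exp (- r) * ((2 * r) ^ k /\<^sub>R fact k)) = (\<lambda>k. pmf (poisson_pmf r) k * 2 ^ k)"
      using assms by (simp add: fun_eq_iff pmf_poisson power_mult_distrib field_simps)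
    finally show "(\<lambda>k. pmf (poisson_pmf r) k * 2 ^ k) sums exp r" .
  qed simp
  finally show ?thesis .
qed

context prob_space
begin

text \<open>Chernoff bound with base 2: by independence, 2 to the total count has mean
  \<open>exp r ^ (2 * m + 1)\<close>, one factor per level, and Markov's inequality at
  \<open>2 ^ K\<close> concludes.\<close>

lemma prob_total_count_poisson:
  assumes N: "indep_vars (\<lambda>_. count_space UNIV) N UNIV"
    and poisson: "\<And>i. distr M (count_space UNIV) (N i) = measure_pmf (poisson_pmf r)"
    and r: "0 < r"
  shows "{\<omega> \<in> space M. total_count (\<lambda>k. N k \<omega>) m > K} \<in> events"
    and "prob {\<omega> \<in> space M. total_count (\<lambda>k. N k \<omega>) m > K} \<le> exp r ^ (2 * m + 1) / 2 ^ K"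
proof -
  let ?I = "{-int m..int m}"
  have [measurable]: "N i \<in> M \<rightarrow>\<^sub>M count_space UNIV" for i
    using N by (auto simp: indep_vars_def)
  show "{\<omega> \<in> space M. total_count (\<lambda>k. N k \<omega>) m > K} \<in> events" by measurable
  define u where "u \<omega> = (\<Prod>k\<in>?I. ennreal (2 ^ N k \<omega>))" for \<omega>
  have u_eq: "u \<omega> = ennreal (2 ^ total_count (\<lambda>k. N k \<omega>) m)" for \<omega>
    by (simp add: u_def prod_ennreal power_sum)
  have [measurable]: "u \<in> borel_measurable M" unfolding u_def by measurable
  have "(\<integral>\<^sup>+\<omega>. u \<omega> \<partial>M) = (\<Prod>k\<in>?I. \<integral>\<^sup>+\<omega>. ennreal (2 ^ N k \<omega>) \<partial>M)"
    unfolding u_def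
  proof (rule indep_vars_nn_integral)
    show "indep_vars (\<lambda>_. borel) (\<lambda>k \<omega>. ennreal (2 ^ N k \<omega>)) ?I"
      using indep_vars_compose2[OF indep_vars_subset[OF N], of ?I "\<lambda>_ x. ennreal (2 ^ x)" "\<lambda>_. borel"]
      by simp
  qed simp_all
  also have "\<dots> = (\<Prod>k\<in>?I. ennreal (exp r))"
  proof (rule prod.cong[OF refl])
    fix k
    have "(\<integral>\<^sup>+\<omega>. ennreal (2 ^ N k \<omega>) \<partial>M) = (\<integral>\<^sup>+x. ennreal (2 ^ x) \<partial>distr M (count_space UNIV) (N k))"
      by (subst nn_integral_distr) auto
    then show "(\<integral>\<^sup>+\<omega>. ennreal (2 ^ N k \<omega>) \<partial>M) = ennreal (exp r)"
      using nn_integral_two_power_poisson[OF r] by (simp add: poisson)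
  qed
  also have "\<dots> = ennreal (exp r ^ (2 * m + 1))"
  proof -
    have "card ?I = 2 * m + 1" by simp
    then show ?thesis by (simp only: prod_constant ennreal_power[OF exp_ge_zero])
  qed
  finally have int: "(\<integral>\<^sup>+\<omega>. u \<omega> \<partial>M) = ennreal (exp r ^ (2 * m + 1))" .
  have "emeasure M {\<omega> \<in> space M. total_count (\<lambda>k. N k \<omega>) m > K} \<le>
      emeasure M {\<omega> \<in> space M. 1 \<le> ennreal (1 / 2 ^ K) * u \<omega>}"
  proof (rule emeasure_mono)
    have "1 \<le> ennreal (1 / 2 ^ K) * ennreal (2 ^ t)" if "K < t" for t :: nat
    proof -
      have "(2::real) ^ K \<le> 2 ^ t" using that by simp
      then have "1 \<le> 1 / 2 ^ K * (2 :: real) ^ t" by (simp add: field_simps)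
      then show ?thesis by (simp flip: ennreal_mult)
    qed
    then show "{\<omega> \<in> space M. total_count (\<lambda>k. N k \<omega>) m > K}
        \<subseteq> {\<omega> \<in> space M. 1 \<le> ennreal (1 / 2 ^ K) * u \<omega>}"
      by (auto simp: u_eq)
  qed measurable
  also have "\<dots> \<le> ennreal (1 / 2 ^ K) * (\<integral>\<^sup>+\<omega>. u \<omega> * indicator (space M) \<omega> \<partial>M)"
    by (rule nn_integral_Markov_inequality) auto
  also have "(\<integral>\<^sup>+\<omega>. u \<omega> * indicator (space M) \<omega> \<partial>M) = (\<integral>\<^sup>+\<omega>. u \<omega> \<partial>M)"
    by (rule nn_integral_cong) simp
  also have "ennreal (1 / 2 ^ K) * (\<integral>\<^sup>+\<omega>. u \<omega> \<partial>M) = ennreal (exp r ^ (2 * m + 1) / 2 ^ K)"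
    unfolding int by (simp flip: ennreal_mult)
  finally show "prob {\<omega> \<in> space M. total_count (\<lambda>k. N k \<omega>) m > K} \<le> exp r ^ (2 * m + 1) / 2 ^ K"
    by (simp add: emeasure_eq_measure)
qed

text \<open>The slope 8 is generous: for positive \<open>m\<close>, \<open>exp 1 \<le> 3\<close> and
  \<open>2 * m + 1 \<le> 3 * m\<close> bound the mean by \<open>27 ^ (n * m)\<close>, against
  \<open>2 ^ (8 * n * m) = 256 ^ (n * m)\<close> in the denominator. The ratio is summable, and
  Borel-Cantelli applies.\<close>

lemma AE_total_count_poisson:
  assumes N: "indep_vars (\<lambda>_. count_space UNIV) N UNIV"
    and poisson: "\<And>i. distr M (count_space UNIV) (N i) = measure_pmf (poisson_pmf (real n))"
    and n: "1 \<le> n"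
  shows "AE \<omega> in M. \<forall>\<^sub>F m in sequentially. total_count (\<lambda>k. N k \<omega>) m \<le> 8 * n * m"
proof -
  let ?E = "\<lambda>m. {\<omega> \<in> space M. total_count (\<lambda>k. N k \<omega>) m > 8 * n * m}"
  have "0 < real n" using n by simp
  note P = prob_total_count_poisson[OF N poisson this]
  have bound: "prob (?E m) \<le> (1 / 2) ^ m" for m
  proof (cases "m = 0")
    case False
    have "exp (real n) ^ (2 * m + 1) = exp 1 ^ (n * (2 * m + 1))"
      using exp_of_nat_mult[of n "1 :: real"] by (simp only: power_mult mult_1_right)
    also have "\<dots> \<le> 3 ^ (n * (2 * m + 1))"
      by (intro power_mono exp_le) simp
    also have "\<dots> \<le> 3 ^ (3 * (n * m))"
      using False by (intro power_increasing) (auto simp: algebra_simps)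
    also have "\<dots> = (27 :: real) ^ (n * m)"
      by (simp add: power_mult)
    finally have e: "exp (real n) ^ (2 * m + 1) \<le> 27 ^ (n * m)" .
    have "prob (?E m) \<le> exp (real n) ^ (2 * m + 1) / 2 ^ (8 * n * m)" by (rule P(2))
    also have "\<dots> \<le> 27 ^ (n * m) / 2 ^ (8 * n * m)"
      using e by (intro divide_right_mono) auto
    also have "\<dots> = (27 / 256) ^ (n * m)"
      by (simp add: power_divide power_mult mult.assoc)
    also have "\<dots> \<le> (1 / 2) ^ (n * m)" by (intro power_mono) auto
    also have "\<dots> \<le> (1 / 2) ^ m" using n by (intro power_decreasing) auto
    finally show ?thesis .
  qed simp
  have "summable (\<lambda>m. (1 / 2 :: real) ^ m)" by (rule summable_geometric) simp
  then have "summable (\<lambda>m. prob (?E m))"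
    by (rule summable_comparison_test_ev[rotated]) (use bound in auto)
  then have "AE \<omega> in M. \<forall>\<^sub>F m in sequentially. \<omega> \<in> space M - ?E m"
    using P(1) by (intro borel_cantelli_AE1) (auto simp: less_top[symmetric])
  then show ?thesis
    by eventually_elim (auto elim!: eventually_mono simp: not_less)
qed

end

section \<open>Fixed and Poisson counts as two instances\<close>

theorem theorem3p1:
  fixes P :: "'w measure"
    and S :: "int \<Rightarrow> nat \<Rightarrow> nat \<Rightarrow> 'w \<Rightarrow> int \<times> int"
    and n :: nat and \<alpha> :: real
  assumes "prob_space P"
    and "walk_family P S"
    and "n \<ge> 1"
    and "\<alpha> > 1"
  shows "(AE \<omega> in P. \<exists>M\<^sub>0\<ge>1. \<forall>M\<ge>M\<^sub>0.
            \<forall>(i, j) \<in> contributing_particles (\<lambda>_. n).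
              real_of_int \<bar>i\<bar> > real M powr \<alpha> \<longrightarrow>
              particle_trajectory (\<lambda>_. n) (\<lambda>i j t. S i j t \<omega>) i j \<inter> strip M = {})
       \<and> (\<forall>N :: int \<Rightarrow> 'w \<Rightarrow> nat. poisson_counts P S (real n) N \<longrightarrow>
            (AE \<omega> in P. \<exists>M\<^sub>0\<ge>1. \<forall>M\<ge>M\<^sub>0.
               \<forall>(i, j) \<in> contributing_particles (\<lambda>i. N i \<omega>).
                 real_of_int \<bar>i\<bar> > real M powr \<alpha> \<longrightarrow>
                 particle_trajectory (\<lambda>i. N i \<omega>) (\<lambda>i j t. S i j t \<omega>) i j \<inter> strip M = {}))"
proof (intro conjI allI impI)
  interpret prob_space P by (rule assms(1))
  \<comment> \<open>The slope \<open>3 * n\<close> comes from \<open>2 * m + 1 \<le> 3 * m\<close>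
    levels, valid from \<open>m = 1\<close> on.\<close>
  have "\<forall>\<^sub>F m in sequentially. total_count (\<lambda>_. n) m \<le> 3 * n * m"
  proof (rule eventually_mono[OF eventually_ge_at_top[of 1]])
    fix m :: nat assume "1 \<le> m"
    then have "(2 * m + 1) * n \<le> (3 * m) * n" by (intro mult_right_mono) auto
    moreover have "total_count (\<lambda>_. n) m = card {-int m..int m} * n" by simp
    moreover have "card {-int m..int m} = 2 * m + 1" by simp
    ultimately show "total_count (\<lambda>_. n) m \<le> 3 * n * m" by (simp only: mult_ac)
  qed
  then show "AE \<omega> in P. \<exists>M\<^sub>0\<ge>1. \<forall>M\<ge>M\<^sub>0. \<forall>(i, j) \<in> contributing_particles (\<lambda>_. n).
      real_of_int \<bar>i\<bar> > real M powr \<alpha> \<longrightarrow>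
      particle_trajectory (\<lambda>_. n) (\<lambda>i j t. S i j t \<omega>) i j \<inter> strip M = {}"
    by (intro AE_trajectories_avoid_strip[where N = "\<lambda>_ _. n" and K = "3 * n"] assms
        indep_set_constant_counts AE_I2)
next
  interpret prob_space P by (rule assms(1))
  fix N :: "int \<Rightarrow> 'w \<Rightarrow> nat" assume "poisson_counts P S (real n) N"
  then show "AE \<omega> in P. \<exists>M\<^sub>0\<ge>1. \<forall>M\<ge>M\<^sub>0. \<forall>(i, j) \<in> contributing_particles (\<lambda>i. N i \<omega>).
      real_of_int \<bar>i\<bar> > real M powr \<alpha> \<longrightarrow>
      particle_trajectory (\<lambda>i. N i \<omega>) (\<lambda>i j t. S i j t \<omega>) i j \<inter> strip M = {}"
    by (intro AE_trajectories_avoid_strip[where K = "8 * n"] assms AE_total_count_poisson)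
      (auto simp: poisson_counts_def)
qed

end
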